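(* Let $n\ge d\ge2$, fix a base point $p\in\mathcal{B}$ and a reference lift $X_p\in\mathcal{E}$ with $\pi(X_p)=p$. Suppose the curvature values reachable from $p$, transported back to $p$, span all of $\mathfrak{so}(d)$, i.e. $$\operatorname{span}\{\mathrm{Ad}_{\tau_{q\to p}}(\Omega_q(u,v)) : q \text{ horizontally reachable from } p,\ u,v\in\mathcal{H}_q\}=\mathfrak{so}(d).$$ Then the restricted holonomy group at $p$ is $\mathrm{Hol}_p^0=\mathrm{SO}(d)$.
   Context: $\mathcal{E}$ is the open set of $X\in\mathbb{R}^{n\times d}$ of rank $d$, with rows $x_i^\top$, such that $0<x_i^\top x_j<1$ for all $i,j$; $\pi(X)=XX^\top$, $\mathcal{B}=\pi(\mathcal{E})$. $O(d)$ acts freely on $\mathcal{E}$ by right multiplication and $\pi:\mathcal{E}\to\mathcal{B}\cong\mathcal{E}/O(d)$ is a principal $O(d)$-bundle. The horizontal spaces $\mathcal{H}_X=\{Z\in\mathbb{R}^{n\times d}:X^\top Z\text{ symmetric}\}$ define a principal connection with connection form $\omega_X(Z)=$ the unique skew-symmetric $W$ with $(X^\top X)W+W(X^\top X)=X^\top Z-Z^\top X$. The curvature is the $\mathfrak{so}(d)$-valued 2-form with $\Omega(H_1,H_2)=-\omega([H_1,H_2])$ for horizontal vector fields $H_1,H_2$; $\Omega_q(u,v)$ denotes its value at $q\in\mathcal{E}$ on $u,v\in\mathcal{H}_q$. A point $q\in\mathcal{E}$ is horizontally reachable from $p$ if it can be joined to $X_p$ by a piecewise smooth horizontal curve in $\mathcal{E}$.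 $\mathrm{Ad}_{\tau_{q\to p}}$ denotes parallel transport of the curvature value back to the fiber over $p$ along such a horizontal curve; since $q$ is itself the endpoint of a horizontal curve starting at $X_p$, in the reference frame $X_p$ this transported value is simply the element $\Omega_q(u,v)\in\mathfrak{so}(d)$. For a closed curve $\gamma$ in $\mathcal{B}$ based at $p$, the horizontal lift starting at $X_p$ ends at $X_pQ_\gamma$ with $Q_\gamma\in O(d)$ its holonomy. $\mathrm{Hol}_p^0$ is the restricted holonomy group: the group of all $Q_\gamma$ for $\gamma$ contractible loops at $p$. *)

theory Defs
  imports "HOL-Analysis.Analysis"
begin

section \<open>Smooth maps\<close>

text \<open>For open \<open>S\<close>, \<open>Ck_on k S f\<close> says that \<open>f\<close> is \<open>k\<close> times continuously differentiable on \<open>S\<close>: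
  all iterated directional derivatives up to order \<open>k\<close> exist and are continuous.\<close>

primrec Ck_on :: "nat \<Rightarrow> 'a::euclidean_space set \<Rightarrow> ('a \<Rightarrow> 'b::euclidean_space) \<Rightarrow> bool" where
  "Ck_on 0 S f \<longleftrightarrow> continuous_on S f"
| "Ck_on (Suc k) S f \<longleftrightarrow>
     (\<forall>x\<in>S. f differentiable at x) \<and>
     (\<forall>v. Ck_on k S (\<lambda>x. frechet_derivative f (at x) v))"

definition smooth_on :: "'a::euclidean_space set \<Rightarrow> ('a \<Rightarrow> 'b::euclidean_space) \<Rightarrow> bool" where
  "smooth_on S f \<longleftrightarrow> (\<forall>k. Ck_on k S f)"

definition smooth_arc :: "real \<Rightarrow> real \<Rightarrow> (real \<Rightarrow> 'b::euclidean_space) \<Rightarrow> bool" where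
  "smooth_arc a b g \<longleftrightarrow>
     (\<exists>U h. open U \<and> {a..b} \<subseteq> U \<and> smooth_on U h \<and> (\<forall>t\<in>{a..b}. h t = g t))"

text \<open>Paths are parametrised by \<open>{0..1}\<close>; the finite set \<open>S\<close> contains the break points, and the
  path is smooth up to the end points on each closed interval between break points. (The
  predicate \<^const>\<open>piecewise_C1_differentiable_on\<close> would only give class \<open>C\<^sup>1\<close>.)\<close>

definition piecewise_smooth_path :: "(real \<Rightarrow> 'b::euclidean_space) \<Rightarrow> bool" where
  "piecewise_smooth_path g \<longleftrightarrow> path g \<and>
     (\<exists>S. finite S \<and>
        (\<forall>a b. 0 \<le> a \<and> a < b \<and> b \<le> 1 \<and> S \<inter> {a<..<b} = {} \<longrightarrow> smooth_arc a b g))"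

section \<open>The bundle\<close>

text \<open>A matrix of type \<open>real^'d^'n\<close> has \<open>CARD('n)\<close> rows and \<open>CARD('d)\<close> columns, and
  \<open>X $ i\<close> is its \<open>i\<close>-th row.\<close>

definition total_space :: "(real^'d^'n) set" where
  "total_space = {X. rank X = CARD('d) \<and> (\<forall>i j. 0 < X $ i \<bullet> X $ j \<and> X $ i \<bullet> X $ j < 1)}"

definition bundle_proj :: "real^'d^'n \<Rightarrow> real^'n^'n" where
  "bundle_proj X = X ** transpose X"

text \<open>The target type does not determine \<open>'d\<close>, so the base space carries it as an explicit
  type argument.\<close>

definition base_space :: "'d::finite itself \<Rightarrow> (real^'n^'n) set" where
  "base_space _ = bundle_proj ` (total_space :: (real^'d^'n) set)"

definition skew_matrices :: "(real^'d^'d) set" where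
  "skew_matrices = {W. transpose W = - W}"

section \<open>The connection and its curvature\<close>

definition horizontal_space :: "real^'d^'n \<Rightarrow> (real^'d^'n) set" where
  "horizontal_space X = {Z. transpose (transpose X ** Z) = transpose X ** Z}"

definition connection_form :: "real^'d^'n \<Rightarrow> real^'d^'n \<Rightarrow> real^'d^'d" where
  "connection_form X Z =
     (THE W. W \<in> skew_matrices \<and>
        (transpose X ** X) ** W + W ** (transpose X ** X) =
        transpose X ** Z - transpose Z ** X)"

text \<open>The sign is that of the commutator of derivations, \<open>[H\<^sub>1,H\<^sub>2]f = H\<^sub>1(H\<^sub>2 f) - H\<^sub>2(H\<^sub>1 f)\<close>.\<close>

definition lie_bracket :: "('a::euclidean_space \<Rightarrow> 'a) \<Rightarrow> ('a \<Rightarrow> 'a) \<Rightarrow> 'a \<Rightarrow> 'a" where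
  "lie_bracket H1 H2 x =
     frechet_derivative H2 (at x) (H1 x) - frechet_derivative H1 (at x) (H2 x)"

definition horizontal_field :: "(real^'d^'n \<Rightarrow> real^'d^'n) \<Rightarrow> bool" where
  "horizontal_field H \<longleftrightarrow> smooth_on total_space H \<and> (\<forall>X\<in>total_space. H X \<in> horizontal_space X)"

text \<open>The value on horizontal vectors \<open>u\<close>, \<open>v\<close> at \<open>q\<close> is computed from horizontal fields extending
  them. Extensions exist (project constant fields), and the result does not depend on them:
  differentiating the symmetry of \<open>X\<^sup>T H\<^sub>i\<close> shows that \<open>[H\<^sub>1,H\<^sub>2](q)\<close> enters the equation defining
  \<^const>\<open>connection_form\<close> only through \<open>-2 (u\<^sup>T v - v\<^sup>T u)\<close>.\<close>

definition curvature :: "real^'d^'n \<Rightarrow> real^'d^'n \<Rightarrow> real^'d^'n \<Rightarrow> real^'d^'d" where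
  "curvature q u v =
     (THE W. \<exists>H1 H2. horizontal_field H1 \<and> horizontal_field H2 \<and> H1 q = u \<and> H2 q = v \<and>
        W = - connection_form q (lie_bracket H1 H2 q))"

section \<open>Horizontal paths and holonomy\<close>

text \<open>The velocity of a piecewise smooth path exists off a finite set; horizontality is required
  wherever it exists.\<close>

definition horizontal_path :: "(real \<Rightarrow> real^'d^'n) \<Rightarrow> bool" where
  "horizontal_path g \<longleftrightarrow> piecewise_smooth_path g \<and> path_image g \<subseteq> total_space \<and>
     (\<forall>t\<in>{0..1}. \<forall>Z. (g has_vector_derivative Z) (at t within {0..1}) \<longrightarrow>
        Z \<in> horizontal_space (g t))"

definition horizontally_reachable :: "real^'d^'n \<Rightarrow> real^'d^'n \<Rightarrow> bool" where
  "horizontally_reachable Xp q \<longleftrightarrow>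
     (\<exists>g. horizontal_path g \<and> pathstart g = Xp \<and> pathfinish g = q)"

text \<open>The curvature values transported back to the fibre over the base point: as \<open>q\<close> is the end
  point of a horizontal path starting at \<open>Xp\<close>, the transported value in the frame \<open>Xp\<close> is the
  element \<open>curvature q u v\<close> itself.\<close>

definition transported_curvature_values :: "real^'d^'n \<Rightarrow> (real^'d^'d) set" where
  "transported_curvature_values Xp =
     {curvature q u v | q u v. horizontally_reachable Xp q \<and>
        u \<in> horizontal_space q \<and> v \<in> horizontal_space q}"

definition horizontal_lift :: "(real \<Rightarrow> real^'n^'n) \<Rightarrow> (real \<Rightarrow> real^'d^'n) \<Rightarrow> bool" where
  "horizontal_lift \<gamma> g \<longleftrightarrow> horizontal_path g \<and> (\<forall>t\<in>{0..1}. bundle_proj (g t) = \<gamma> t)"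

definition has_holonomy :: "real^'d^'n \<Rightarrow> (real \<Rightarrow> real^'n^'n) \<Rightarrow> real^'d^'d \<Rightarrow> bool" where
  "has_holonomy Xp \<gamma> Q \<longleftrightarrow> orthogonal_matrix Q \<and>
     (\<exists>g. horizontal_lift \<gamma> g \<and> pathstart g = Xp \<and> pathfinish g = Xp ** Q)"

definition contractible_loop :: "'d::finite itself \<Rightarrow> real^'n^'n \<Rightarrow> (real \<Rightarrow> real^'n^'n) \<Rightarrow> bool" where
  "contractible_loop D p \<gamma> \<longleftrightarrow> piecewise_smooth_path \<gamma> \<and> pathstart \<gamma> = p \<and> pathfinish \<gamma> = p \<and>
     homotopic_paths (base_space D) \<gamma> (linepath p p)"

definition restricted_holonomy :: "real^'n^'n \<Rightarrow> real^'d^'n \<Rightarrow> (real^'d^'d) set" where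
  "restricted_holonomy p Xp = {Q. \<exists>\<gamma>. contractible_loop TYPE('d) p \<gamma> \<and> has_holonomy Xp \<gamma> Q}"

end

theory Submission
  imports Defs
begin

text \<open>Straight segments from \<open>X\<close> to \<open>Y\<close> with \<open>X\<^sup>T Y\<close> symmetric are horizontal, and every horizontal vector
  at \<open>q\<close> has the form \<open>U q\<close> with \<open>U\<close> symmetric. Hence the broken line through
  \<open>q\<close>, \<open>y\<^sub>1 = (I + s\<^sub>1 U) q\<close>, \<open>y\<^sub>2 = (I + s\<^sub>2 Y) y\<^sub>1\<close> and \<open>q R\<close>, where \<open>R\<close> is the orthogonal polar factor of
  \<open>q\<^sup>T y\<^sub>2\<close>, is a horizontal lift of a small loop with holonomy \<open>R\<close>. With \<open>s\<^sub>1 s\<^sub>2 = t\<close> the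
  curve \<open>t \<mapsto> R\<close> is differentiable at \<open>0\<close>, and its velocity is a multiple of the curvature at
  \<open>U q\<close>, \<open>Y q\<close>; a lasso carries it to the base point. As these velocities span the skew matrices, the
  open mapping theorem for continuous maps that are differentiable at one point puts a
  neighbourhood of \<open>I\<close> in \<open>O(d)\<close> into the holonomy group, which therefore contains \<open>SO(d)\<close>.
  Conversely, the vector of \<open>d \<times> d\<close> minors of a lift is determined up to sign
  by the projection and is multiplied by \<open>det Q\<close> under \<open>X \<mapsto> X Q\<close>, so monodromy of the double
  cover \<open>v \<mapsto> v v\<^sup>T\<close> forces \<open>det Q = 1\<close> for contractible loops.\<close>

section \<open>Matrices\<close>

lemma bounded_bilinear_matrix_mult:
  "bounded_bilinear ((**) :: real^'b^'a \<Rightarrow> real^'c^'b \<Rightarrow> real^'c^'a)"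
proof -
  have "bilinear ((**) :: real^'b^'a \<Rightarrow> real^'c^'b \<Rightarrow> real^'c^'a)"
    unfolding bilinear_def
    by (auto intro!: linearI simp: vec_eq_iff matrix_matrix_mult_def sum.distrib sum_distrib_left
        distrib_left distrib_right ac_simps)
  then show ?thesis
    by (simp add: bilinear_conv_bounded_bilinear)
qed

interpretation matrix_mult: bounded_bilinear "(**) :: real^'b^'a \<Rightarrow> real^'c^'b \<Rightarrow> real^'c^'a"
  by (rule bounded_bilinear_matrix_mult)

lemma bounded_linear_transpose: "bounded_linear (transpose :: real^'b^'a \<Rightarrow> real^'a^'b)"
  unfolding linear_conv_bounded_linear[symmetric]
  by (rule linearI) (simp_all add: vec_eq_iff transpose_def)

lemmas transpose_linear_simps =
  bounded_linear.linear[OF bounded_linear_transpose, THEN linear_add]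
  bounded_linear.linear[OF bounded_linear_transpose, THEN linear_diff]
  bounded_linear.linear[OF bounded_linear_transpose, THEN linear_neg]
  bounded_linear.linear[OF bounded_linear_transpose, THEN linear_cmul]

lemmas matrix_algebra = matrix_mult.add_left matrix_mult.add_right
  matrix_mult.diff_left matrix_mult.diff_right matrix_mult.minus_left matrix_mult.minus_right
  matrix_mult.scaleR_left matrix_mult.scaleR_right matrix_mul_assoc
  transpose_linear_simps matrix_transpose_mul

lemma inner_matrix_mult_vector:
  fixes A :: "real^'b^'a"
  shows "x \<bullet> (A *v y) = (transpose A *v x) \<bullet> y"
  by (metis dot_lmul_matrix transpose_matrix_vector)

definition skew_part :: "real^'a^'a \<Rightarrow> real^'a^'a" where
  "skew_part M = (1/2) *\<^sub>R (M - transpose M)"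

definition sym_part :: "real^'a^'a \<Rightarrow> real^'a^'a" where
  "sym_part M = (1/2) *\<^sub>R (M + transpose M)"

lemma skew_part_in_skew_matrices: "skew_part M \<in> skew_matrices"
  by (simp add: skew_part_def skew_matrices_def transpose_linear_simps
      flip: scaleR_minus_right)

lemma transpose_sym_part: "transpose (sym_part M) = sym_part M"
  by (simp add: sym_part_def transpose_linear_simps add.commute)

lemma skew_part_plus_sym_part: "skew_part M + sym_part M = M"
proof -
  have "(1/2) *\<^sub>R M + (1/2) *\<^sub>R M = M"
    by (simp flip: scaleR_add_left)
  then show ?thesis
    by (simp add: skew_part_def sym_part_def algebra_simps)
qed

lemma bounded_linear_skew_part: "bounded_linear (skew_part :: real^'a^'a \<Rightarrow> real^'a^'a)"
  unfolding skew_part_def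
  by (intro bounded_linear_const_scaleR bounded_linear_sub bounded_linear_ident bounded_linear_transpose)

lemma bounded_linear_sym_part: "bounded_linear (sym_part :: real^'a^'a \<Rightarrow> real^'a^'a)"
  unfolding sym_part_def
  by (intro bounded_linear_const_scaleR bounded_linear_add bounded_linear_ident bounded_linear_transpose)

section \<open>Positive definite matrices and the Lyapunov operator\<close>

definition pos_def :: "real^'a^'a \<Rightarrow> bool" where
  "pos_def K \<longleftrightarrow> transpose K = K \<and> (\<forall>x. x \<noteq> 0 \<longrightarrow> 0 < x \<bullet> (K *v x))"

lemma pos_def_invertible:
  assumes "pos_def K" shows "invertible K"
proof -
  have "x = 0" if "K *v x = 0" for x
  proof (rule ccontr)
    assume "x \<noteq> 0"
    then have "0 < x \<bullet> (K *v x)"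
      using assms unfolding pos_def_def by simp
    then show False
      using that by simp
  qed
  then show ?thesis
    by (metis invertible_left_inverse matrix_left_invertible_ker)
qed

text \<open>The entrywise inner product of \<open>K D + D K\<close> with \<open>D\<close> is the sum of \<open>x \<bullet> K x\<close> over the rows and
  columns \<open>x\<close> of \<open>D\<close>.\<close>

lemma lyapunov_injective:
  assumes K: "pos_def K" and eq: "K ** D + D ** K = 0"
  shows "D = 0"
proof -
  have tr: "(\<Sum>i\<in>UNIV. column i D \<bullet> (K *v column i D)) + (\<Sum>i\<in>UNIV. D $ i \<bullet> (K *v (D $ i))) =
     (\<Sum>i\<in>UNIV. \<Sum>j\<in>UNIV. D $ i $ j * (K ** D + D ** K) $ i $ j)"
  proof -
    have 1: "(\<Sum>i\<in>UNIV. column i D \<bullet> (K *v column i D)) = (\<Sum>i\<in>UNIV. \<Sum>j\<in>UNIV. D $ i $ j * (K ** D) $ i $ j)"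
      unfolding inner_vec_def column_def matrix_vector_mult_def matrix_matrix_mult_def
      by (subst sum.swap) simp
    have Kt: "K $ i $ j = K $ j $ i" for i j
    proof -
      have "transpose K $ i $ j = K $ i $ j"
        using K unfolding pos_def_def by simp
      then show ?thesis
        by (simp add: transpose_def)
    qed
    have 2: "(\<Sum>i\<in>UNIV. D $ i \<bullet> (K *v (D $ i))) = (\<Sum>i\<in>UNIV. \<Sum>j\<in>UNIV. D $ i $ j * (D ** K) $ i $ j)"
      unfolding inner_vec_def matrix_vector_mult_def matrix_matrix_mult_def
      by (intro sum.cong refl arg_cong2[of _ _ _ _ "(*)"]) (simp, subst Kt, simp add: mult.commute)
    show ?thesis
      unfolding 1 2 by (simp add: sum.distrib distrib_left)
  qed
  have nn: "0 \<le> x \<bullet> (K *v x)" for x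
    using K unfolding pos_def_def by (cases "x = 0") (auto intro: less_imp_le)
  have "(\<Sum>i\<in>UNIV. D $ i \<bullet> (K *v (D $ i))) = 0"
    using tr eq sum_nonneg[of UNIV "\<lambda>i. D $ i \<bullet> (K *v (D $ i))"]
      sum_nonneg[of UNIV "\<lambda>i. column i D \<bullet> (K *v column i D)"] nn by (simp add: add_nonneg_eq_0_iff)
  then have "D $ i \<bullet> (K *v (D $ i)) = 0" for i
    using nn by (simp add: sum_nonneg_eq_0_iff)
  then have "D $ i = 0" for i
    using K unfolding pos_def_def by (cases "D $ i = 0") (auto dest!: spec[of _ "D $ i"])
  then show ?thesis
    by (simp add: vec_eq_iff)
qed

lemma bounded_linear_lyapunov: "bounded_linear (\<lambda>D. K ** D + D ** K)" for K :: "real^'a^'a"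
  by (intro bounded_linear_add matrix_mult.bounded_linear_right matrix_mult.bounded_linear_left)

lemma lyapunov_inj: "pos_def K \<Longrightarrow> inj (\<lambda>D. K ** D + D ** K)"
  using linear_injective_0[OF bounded_linear.linear[OF bounded_linear_lyapunov]] lyapunov_injective
  by blast

text \<open>An injective linear endomorphism in finite dimension is onto. With \<open>K\<close>
  symmetric and \<open>B\<close> skew, \<open>- transpose W\<close> solves the same equation as
  \<open>W\<close>, so uniqueness forces \<open>W\<close> to be skew. On the total space this makes
  the description in \<open>connection_form\<close> meaningful.\<close>

lemma lyapunov_skew_solution:
  assumes K: "pos_def K" and B: "B \<in> skew_matrices"
  shows "\<exists>!W. W \<in> skew_matrices \<and> K ** W + W ** K = B"
proof -
  have inj: "inj (\<lambda>D. K ** D + D ** K)"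
    by (rule lyapunov_inj[OF K])
  then have "surj (\<lambda>D. K ** D + D ** K)"
    by (simp add: linear_injective_imp_surjective bounded_linear.linear[OF bounded_linear_lyapunov])
  then obtain W where W: "B = K ** W + W ** K"
    using surjD[of "\<lambda>D. K ** D + D ** K" B] by blast
  have "transpose K = K" "transpose B = - B"
    using K B by (auto simp: pos_def_def skew_matrices_def)
  then have "K ** transpose W + transpose W ** K = - B"
    using arg_cong[OF W, of transpose] by (simp add: matrix_algebra add.commute)
  then have "- (K ** transpose W + transpose W ** K) = B"
    by (simp only: minus_minus)
  then have "K ** (- transpose W) + (- transpose W) ** K = B"
    by (simp add: matrix_algebra)
  then have "- transpose W = W"
    using injD[OF inj, of "- transpose W" W] W by simp
  then have "W \<in> skew_matrices"
    by (simp add: skew_matrices_def minus_equation_iff)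
  then show ?thesis
    using injD[OF inj, of _ W] W by (intro ex1I[of _ W]) simp_all
qed

lemma matrix_inv_right: "invertible A \<Longrightarrow> A ** matrix_inv A = mat 1"
  and matrix_inv_left: "invertible A \<Longrightarrow> matrix_inv A ** A = mat 1"
  unfolding invertible_def matrix_inv_def by (drule someI_ex, simp)+

text \<open>Cramer's rule writes each entry of the inverse as a quotient of determinants, which are
  polynomial in the entries.\<close>

lemma continuous_on_matrix_inv:
  fixes f :: "'t::topological_space \<Rightarrow> real^'a^'a"
  assumes "continuous_on S f" "\<And>x. x \<in> S \<Longrightarrow> invertible (f x)"
  shows "continuous_on S (\<lambda>x. matrix_inv (f x))"
proof -
  have inv: "matrix_inv A $ k $ j = det (\<chi> i l. if l = k then axis j 1 $ i else A $ i $ l) / det A"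
    if "invertible A" for A :: "real^'a^'a" and k j
  proof -
    have "A *v (matrix_inv A *v axis j 1) = axis j 1"
      using that by (simp add: matrix_vector_mul_assoc matrix_inv_right)
    then have "matrix_inv A *v axis j 1 = (\<chi> k. det (\<chi> i l. if l = k then axis j 1 $ i else A $ i $ l) / det A)"
      using cramer[of A "matrix_inv A *v axis j 1" "axis j 1"] that by (simp add: invertible_det_nz)
    then have "(matrix_inv A *v axis j 1) $ k = det (\<chi> i l. if l = k then axis j 1 $ i else A $ i $ l) / det A"
      by simp
    then show ?thesis
      by (simp add: matrix_vector_mult_def axis_def if_distrib cong: if_cong)
  qed
  have "continuous_on S (\<lambda>x. \<chi> k j. det (\<chi> i l. if l = k then axis j 1 $ i else f x $ i $ l) / det (f x))"
  proof (intro continuous_on_vec_lambda continuous_on_divide)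
    show "continuous_on S (\<lambda>x. det (f x))"
      unfolding det_def by (intro continuous_intros assms)
    show "continuous_on S (\<lambda>x. det (\<chi> i l. if l = k then axis j 1 $ i else f x $ i $ l))" for k j
    proof -
      have "continuous_on S (\<lambda>x. if l = k then axis j 1 $ i else f x $ i $ l)" for i l
        by (cases "l = k") (auto intro!: continuous_intros assms)
      then show ?thesis
        unfolding det_def by (auto intro!: continuous_intros)
    qed
  qed (use assms invertible_det_nz in auto)
  then show ?thesis
    by (rule continuous_on_eq) (simp add: inv assms vec_eq_iff)
qed

section \<open>Smooth maps and paths\<close>

lemma Ck_on_cong:
  assumes "open S" "\<And>x. x \<in> S \<Longrightarrow> f x = g x" "Ck_on k S f"
  shows "Ck_on k S g"
  using assms(2,3)
proof (induction k arbitrary: f g)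
  case 0
  then show ?case
    by (simp cong: continuous_on_cong)
next
  case (Suc k)
  have f: "(f has_derivative frechet_derivative f (at x)) (at x)" if "x \<in> S" for x
    using Suc.prems(2) that by (auto simp: frechet_derivative_works[symmetric])
  \<comment> \<open>Openness of \<open>S\<close> makes \<open>f\<close> and \<open>g\<close> agree
    near \<open>x\<close>, so they share the derivative there.\<close>
  have *: "(g has_derivative frechet_derivative f (at x)) (at x)" if "x \<in> S" for x
    using has_derivative_transform_within_open[OF f[OF that] assms(1) that] Suc.prems(1) by auto
  then have "\<forall>x\<in>S. g differentiable at x"
    by (auto simp: differentiable_def)
  moreover have "frechet_derivative f (at x) = frechet_derivative g (at x)" if "x \<in> S" for x
    by (rule frechet_derivative_at[OF *[OF that]])
  then have "Ck_on k S (\<lambda>x. frechet_derivative g (at x) v)" for v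
    using Suc.IH[of "\<lambda>x. frechet_derivative f (at x) v" "\<lambda>x. frechet_derivative g (at x) v"] Suc.prems(2)
    by simp
  ultimately show ?case
    by simp
qed

text \<open>Any explicit formula for the derivative may stand in for the chosen
  \<open>frechet_derivative\<close>; the closure properties below then follow by induction on the
  order.\<close>

lemma Ck_on_SucI:
  assumes "open S" "\<And>x. x \<in> S \<Longrightarrow> (f has_derivative f' x) (at x)"
    and "\<And>v. Ck_on k S (\<lambda>x. f' x v)"
  shows "Ck_on (Suc k) S f"
proof -
  have "f' x = frechet_derivative f (at x)" if "x \<in> S" for x
    by (rule frechet_derivative_at[OF assms(2)[OF that]])
  then have "Ck_on k S (\<lambda>x. frechet_derivative f (at x) v)" for v
    using Ck_on_cong[OF assms(1) _ assms(3)[of v], of "\<lambda>x. frechet_derivative f (at x) v"] by simp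
  then show ?thesis
    using assms(2) by (auto simp: differentiable_def)
qed

lemma Ck_on_Suc_has_derivative:
  "Ck_on (Suc k) S f \<Longrightarrow> x \<in> S \<Longrightarrow> (f has_derivative frechet_derivative f (at x)) (at x)"
  by (auto simp: frechet_derivative_works[symmetric])

lemma Ck_on_Suc_imp: "Ck_on (Suc k) S f \<Longrightarrow> Ck_on k S f"
proof (induction k arbitrary: f)
  case 0
  then show ?case
    by (auto simp: continuous_on_eq_continuous_within continuous_at_imp_continuous_within
        differentiable_imp_continuous_within)
next
  case (Suc k)
  then show ?case
    by (metis Ck_on.simps(2))
qed

lemma Ck_on_const: "Ck_on k S (\<lambda>x. c)"
  by (induction k arbitrary: c) auto

lemma Ck_on_bounded_linear_comp:
  assumes "open S" "bounded_linear L" "Ck_on k S f"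
  shows "Ck_on k S (\<lambda>x. L (f x))"
  using assms(3)
proof (induction k arbitrary: f)
  case 0
  then show ?case
    using assms(2) by (auto intro: bounded_linear.continuous_on)
next
  case (Suc k)
  show ?case
    using Suc Ck_on_Suc_has_derivative[OF Suc.prems]
    by (intro Ck_on_SucI[where f' = "\<lambda>x v. L (frechet_derivative f (at x) v)"] assms(1)
        bounded_linear.has_derivative[OF assms(2)]) auto
qed

lemma Ck_on_add:
  assumes "open S" "Ck_on k S f" "Ck_on k S g"
  shows "Ck_on k S (\<lambda>x. f x + g x)"
  using assms(2,3)
proof (induction k arbitrary: f g)
  case 0
  then show ?case by (auto intro: continuous_on_add)
next
  case (Suc k)
  show ?case
    using Suc Ck_on_Suc_has_derivative[OF Suc.prems(1)] Ck_on_Suc_has_derivative[OF Suc.prems(2)]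
    by (intro Ck_on_SucI[where f' = "\<lambda>x v. frechet_derivative f (at x) v + frechet_derivative g (at x) v"]
        assms(1) has_derivative_add) auto
qed

lemma Ck_on_bounded_bilinear:
  assumes "open S" "bounded_bilinear B" "Ck_on k S f" "Ck_on k S g"
  shows "Ck_on k S (\<lambda>x. B (f x) (g x))"
  using assms(3,4)
proof (induction k arbitrary: f g)
  case 0
  then show ?case
    using assms(2) by (auto intro: bounded_bilinear.continuous_on)
next
  case (Suc k)
  \<comment> \<open>In each summand of the Leibniz rule one factor is undifferentiated, and its
    order is lowered from \<open>Suc k\<close> to \<open>k\<close>.\<close>
  have "Ck_on k S (\<lambda>x. B (f x) (frechet_derivative g (at x) v) + B (frechet_derivative f (at x) v) (g x))" for v
    using Suc.prems Suc.prems[THEN Ck_on_Suc_imp] by (intro Ck_on_add Suc.IH \<open>open S\<close>) auto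
  then show ?case
    by (intro Ck_on_SucI[where f' = "\<lambda>x v. B (f x) (frechet_derivative g (at x) v) + B (frechet_derivative f (at x) v) (g x)"]
        assms(1) bounded_bilinear.FDERIV[OF assms(2)] Ck_on_Suc_has_derivative[OF Suc.prems(1)]
        Ck_on_Suc_has_derivative[OF Suc.prems(2)]) auto
qed

lemma smooth_on_bounded_linear:
  assumes "open S" "bounded_linear f" shows "smooth_on S f"
  unfolding smooth_on_def
proof
  fix k
  show "Ck_on k S f"
  proof (cases k)
    case 0
    then show ?thesis
      using assms by (simp add: linear_continuous_on)
  next
    case (Suc k')
    show ?thesis
      unfolding Suc using assms
      by (intro Ck_on_SucI[where f' = "\<lambda>_. f"] bounded_linear_imp_has_derivative Ck_on_const)
  qed
qed

section \<open>Reparametrisation and composition of smooth arcs\<close>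

lemma open_affine_preimage:
  fixes a b :: real
  assumes "open S" shows "open {t. a * t + b \<in> S}"
proof -
  have "continuous_on UNIV (\<lambda>t. a * t + b)"
    by (intro continuous_intros)
  then show ?thesis
    using open_vimage[OF assms] by (simp add: vimage_def)
qed

lemma Ck_on_affine_comp:
  fixes f :: "real \<Rightarrow> 'b::euclidean_space"
  assumes "open S" "Ck_on k S f"
  shows "Ck_on k {t. a * t + b \<in> S} (\<lambda>t. f (a * t + b))"
proof -
  have op: "open {t. a * t + b \<in> S}"
    by (rule open_affine_preimage[OF assms(1)])
  show ?thesis
    using assms(2)
  proof (induction k arbitrary: f)
    case 0
    then show ?case
      by (auto intro!: continuous_on_compose2[of S f] continuous_intros)
  next
    case (Suc k)
    have "((\<lambda>t. f (a * t + b)) has_derivative (\<lambda>v. frechet_derivative f (at (a * t + b)) (a * v))) (at t)"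
      if "a * t + b \<in> S" for t
      using Ck_on_Suc_has_derivative[OF Suc.prems that]
      by (rule has_derivative_compose[of "\<lambda>t. a * t + b", rotated]) (auto intro!: derivative_eq_intros)
    then show ?case
      using Suc.IH Suc.prems
      by (intro Ck_on_SucI[where f' = "\<lambda>t v. frechet_derivative f (at (a * t + b)) (a * v)"] op) auto
  qed
qed

text \<open>The bounds use \<open>min\<close> and \<open>max\<close> so that a negative
  \<open>\<alpha>\<close>, which occurs in path reversal, is covered too.\<close>

lemma smooth_arc_affine:
  assumes g: "smooth_arc (min (\<alpha> * a + \<beta>) (\<alpha> * b + \<beta>)) (max (\<alpha> * a + \<beta>) (\<alpha> * b + \<beta>)) g"
  shows "smooth_arc a b (\<lambda>t. g (\<alpha> * t + \<beta>))"
proof -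
  obtain U h where U: "open U" "{min (\<alpha> * a + \<beta>) (\<alpha> * b + \<beta>)..max (\<alpha> * a + \<beta>) (\<alpha> * b + \<beta>)} \<subseteq> U"
    "smooth_on U h" "\<And>t. t\<in>{min (\<alpha> * a + \<beta>) (\<alpha> * b + \<beta>)..max (\<alpha> * a + \<beta>) (\<alpha> * b + \<beta>)} \<Longrightarrow> h t = g t"
    using g unfolding smooth_arc_def by auto
  have in_range: "\<alpha> * t + \<beta> \<in> {min (\<alpha> * a + \<beta>) (\<alpha> * b + \<beta>)..max (\<alpha> * a + \<beta>) (\<alpha> * b + \<beta>)}" if "t \<in> {a..b}" for t
  proof (cases "\<alpha> \<ge> 0")
    case True
    then show ?thesis
      using that mult_left_mono[of a t \<alpha>] mult_left_mono[of t b \<alpha>] by auto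
  next
    case False
    then show ?thesis
      using that mult_left_mono_neg[of a t \<alpha>] mult_left_mono_neg[of t b \<alpha>] by auto
  qed
  have "open {t. \<alpha> * t + \<beta> \<in> U}"
    by (rule open_affine_preimage[OF U(1)])
  moreover have "smooth_on {t. \<alpha> * t + \<beta> \<in> U} (\<lambda>t. h (\<alpha> * t + \<beta>))"
    using U(3) Ck_on_affine_comp[OF U(1)] unfolding smooth_on_def by blast
  ultimately show ?thesis
    unfolding smooth_arc_def using in_range U(2,4)
    by (intro exI[of _ "{t. \<alpha> * t + \<beta> \<in> U}"] exI[of _ "\<lambda>t. h (\<alpha> * t + \<beta>)"]) auto
qed

lemma smooth_arc_cong:
  "smooth_arc a b g \<Longrightarrow> (\<And>t. t \<in> {a..b} \<Longrightarrow> g t = g' t) \<Longrightarrow> smooth_arc a b g'"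
  unfolding smooth_arc_def by fastforce

text \<open>The regularity of \<open>F\<close> enters as preservation of \<open>Ck_on\<close>, which
  serves linear and quadratic maps alike without a general chain rule.\<close>

lemma smooth_arc_comp:
  assumes "smooth_arc a b g" "\<And>k S (h :: real \<Rightarrow> _). open S \<Longrightarrow> Ck_on k S h \<Longrightarrow> Ck_on k S (\<lambda>t. F (h t))"
  shows "smooth_arc a b (\<lambda>t. F (g t))"
proof -
  obtain U h where "open U" "{a..b} \<subseteq> U" "smooth_on U h" "\<forall>t\<in>{a..b}. h t = g t"
    using assms(1) unfolding smooth_arc_def by (elim exE conjE)
  moreover from this have "smooth_on U (\<lambda>t. F (h t))"
    unfolding smooth_on_def by (simp add: assms(2))
  ultimately show ?thesis
    unfolding smooth_arc_def by (intro exI[of _ U] exI[of _ "\<lambda>t. F (h t)"]) simp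
qed

section \<open>Operations on piecewise smooth paths\<close>

lemma piecewise_smooth_path_comp:
  assumes g: "piecewise_smooth_path g" and F: "continuous_on UNIV F"
    and Ck: "\<And>k S (h :: real \<Rightarrow> _). open S \<Longrightarrow> Ck_on k S h \<Longrightarrow> Ck_on k S (\<lambda>t. F (h t))"
  shows "piecewise_smooth_path (\<lambda>t. F (g t))"
proof -
  have "path (\<lambda>t. F (g t))"
    using g F continuous_on_compose2[of UNIV F "{0..1}" g]
    unfolding piecewise_smooth_path_def path_def by auto
  moreover obtain S where "finite S"
    and S: "\<And>a b. 0 \<le> a \<and> a < b \<and> b \<le> 1 \<and> S \<inter> {a<..<b} = {} \<Longrightarrow> smooth_arc a b g"
    using g unfolding piecewise_smooth_path_def by auto
  moreover have "smooth_arc a b (\<lambda>t. F (g t))"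
    if "0 \<le> a \<and> a < b \<and> b \<le> 1 \<and> S \<inter> {a<..<b} = {}" for a b
    by (rule smooth_arc_comp[where F = F, OF S[OF that] Ck])
  ultimately show ?thesis
    unfolding piecewise_smooth_path_def by (intro conjI exI[of _ S]) simp_all
qed

lemma piecewise_smooth_path_quadratic:
  fixes B :: "'b::euclidean_space \<Rightarrow> 'b \<Rightarrow> 'c::euclidean_space"
  assumes B: "bounded_bilinear B" and g: "piecewise_smooth_path g"
  shows "piecewise_smooth_path (\<lambda>t. B (g t) (g t))"
proof (rule piecewise_smooth_path_comp[OF g, of "\<lambda>x. B x x"])
  show "continuous_on UNIV (\<lambda>x. B x x)"
    by (intro bounded_bilinear.continuous_on[OF B] continuous_on_id)
qed (rule Ck_on_bounded_bilinear[OF _ B])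

lemma piecewise_smooth_path_bounded_linear:
  assumes L: "bounded_linear L" and g: "piecewise_smooth_path g"
  shows "piecewise_smooth_path (\<lambda>t. L (g t))"
proof (rule piecewise_smooth_path_comp[OF g, of L])
  show "continuous_on UNIV L"
    by (rule linear_continuous_on[OF L])
qed (rule Ck_on_bounded_linear_comp[OF _ L])

lemma piecewise_smooth_path_linepath: "piecewise_smooth_path (linepath a b)"
proof -
  have "smooth_on UNIV (\<lambda>t::real. t *\<^sub>R (b - a))"
    by (intro smooth_on_bounded_linear bounded_linear_intros) auto
  then have "smooth_on UNIV (\<lambda>t::real. a + t *\<^sub>R (b - a))"
    unfolding smooth_on_def by (intro allI Ck_on_add Ck_on_const) auto
  then have "smooth_arc s t (linepath a b)" for s t
    unfolding smooth_arc_def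
    by (intro exI[of _ UNIV] exI[of _ "\<lambda>t::real. a + t *\<^sub>R (b - a)"]) (auto simp: linepath_def algebra_simps)
  then show ?thesis
    unfolding piecewise_smooth_path_def by auto
qed

lemma piecewise_smooth_path_reversepath:
  assumes "piecewise_smooth_path g" shows "piecewise_smooth_path (reversepath g)"
proof -
  obtain S where S: "finite S"
    "\<And>a b. 0 \<le> a \<and> a < b \<and> b \<le> 1 \<and> S \<inter> {a<..<b} = {} \<Longrightarrow> smooth_arc a b g"
    using assms unfolding piecewise_smooth_path_def by auto
  have "smooth_arc a b (reversepath g)"
    if "0 \<le> a \<and> a < b \<and> b \<le> 1 \<and> (\<lambda>t. 1 - t) ` S \<inter> {a<..<b} = {}" for a b
  proof -
    have "t \<notin> {1 - b<..<1 - a}" if "t \<in> S" for t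
    proof -
      have "1 - t \<notin> {a<..<b}"
        using that \<open>_ \<and> _ \<and> _ \<and> _\<close> by blast
      then show ?thesis
        by auto
    qed
    then have "S \<inter> {1 - b<..<1 - a} = {}"
      by blast
    then have "smooth_arc (1 - b) (1 - a) g"
      using that by (intro S(2)) auto
    then have "smooth_arc a b (\<lambda>t. g ((-1) * t + 1))"
      using that by (intro smooth_arc_affine) (auto simp: min_def max_def)
    then show ?thesis
      by (simp add: reversepath_def)
  qed
  moreover have "path (reversepath g)" "finite ((\<lambda>t. 1 - t) ` S)"
    using S(1) assms unfolding piecewise_smooth_path_def by auto
  ultimately show ?thesis
    unfolding piecewise_smooth_path_def by blast
qed

lemma piecewise_smooth_path_join:
  assumes "piecewise_smooth_path g1" "piecewise_smooth_path g2" "pathfinish g1 = pathstart g2"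
  shows "piecewise_smooth_path (g1 +++ g2)"
proof -
  obtain S1 where S1: "finite S1"
    "\<And>a b. 0 \<le> a \<and> a < b \<and> b \<le> 1 \<and> S1 \<inter> {a<..<b} = {} \<Longrightarrow> smooth_arc a b g1"
    using assms(1) unfolding piecewise_smooth_path_def by auto
  obtain S2 where S2: "finite S2"
    "\<And>a b. 0 \<le> a \<and> a < b \<and> b \<le> 1 \<and> S2 \<inter> {a<..<b} = {} \<Longrightarrow> smooth_arc a b g2"
    using assms(2) unfolding piecewise_smooth_path_def by auto
  \<comment> \<open>With 1/2 among the break points, every interval free of break points lies in one
    half and is an affine image of such an interval for \<open>g1\<close> or
    \<open>g2\<close>.\<close>
  define S where "S = insert (1/2) ((\<lambda>t. t / 2) ` S1 \<union> (\<lambda>t. (t + 1) / 2) ` S2)"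
  have "smooth_arc a b (g1 +++ g2)"
    if ab: "0 \<le> a \<and> a < b \<and> b \<le> 1 \<and> S \<inter> {a<..<b} = {}" for a b
  proof -
    have "1/2 \<notin> {a<..<b}"
      using ab unfolding S_def by blast
    then consider "b \<le> 1/2" | "1/2 \<le> a"
      by fastforce
    then show ?thesis
    proof cases
      case 1
      have "t \<notin> {2 * a<..<2 * b}" if "t \<in> S1" for t
      proof -
        have "t / 2 \<in> S"
          using that by (auto simp: S_def)
        then have "t / 2 \<notin> {a<..<b}"
          using ab by blast
        then show ?thesis
          by (simp add: field_simps)
      qed
      then have "S1 \<inter> {2 * a<..<2 * b} = {}"
        by blast
      then have "smooth_arc (2 * a) (2 * b) g1"
        using ab 1 by (intro S1(2)) auto
      then have "smooth_arc a b (\<lambda>t. g1 (2 * t + 0))"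
        using ab by (intro smooth_arc_affine) (auto simp: min_def max_def)
      then show ?thesis
        using 1 by (elim smooth_arc_cong) (auto simp: joinpaths_def)
    next
      case 2
      have "t \<notin> {2 * a - 1<..<2 * b - 1}" if "t \<in> S2" for t
      proof -
        have "(t + 1) / 2 \<in> S"
          using that by (auto simp: S_def)
        then have "(t + 1) / 2 \<notin> {a<..<b}"
          using ab by blast
        then show ?thesis
          by (simp add: field_simps)
      qed
      then have "S2 \<inter> {2 * a - 1<..<2 * b - 1} = {}"
        by blast
      then have "smooth_arc (2 * a - 1) (2 * b - 1) g2"
        using ab 2 by (intro S2(2)) auto
      then have "smooth_arc a b (\<lambda>t. g2 (2 * t + (- 1)))"
        using ab by (intro smooth_arc_affine) (auto simp: min_def max_def)
      then show ?thesis
      proof (elim smooth_arc_cong)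
        fix t assume "t \<in> {a..b}"
        \<comment> \<open>At 1/2 the joined path takes its value from \<open>g1\<close>, so the
          common end point is what identifies it with \<open>g2 0\<close>.\<close>
        then consider "t = 1/2" | "1/2 < t"
          using 2 by fastforce
        then show "g2 (2 * t + - 1) = (g1 +++ g2) t"
        proof cases
          case 1
          show ?thesis
            unfolding 1 using assms(3) by (simp add: joinpaths_def pathfinish_def pathstart_def)
        qed (simp add: joinpaths_def)
      qed
    qed
  qed
  moreover have "finite S"
    using S1 S2 by (simp add: S_def)
  moreover have "path (g1 +++ g2)"
    using assms unfolding piecewise_smooth_path_def by simp
  ultimately show ?thesis
    unfolding piecewise_smooth_path_def by blast
qed

section \<open>The bundle\<close>

lemma gram_form: "x \<bullet> ((transpose X ** X) *v x) = (norm (X *v x))\<^sup>2"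
  for X :: "real^'d^'n"
proof -
  have "x \<bullet> ((transpose X ** X) *v x) = x \<bullet> (transpose X *v (X *v x))"
    by (simp only: matrix_vector_mul_assoc)
  also have "\<dots> = (X *v x) \<bullet> (X *v x)"
    by (subst inner_matrix_mult_vector) (simp only: transpose_transpose)
  finally show ?thesis
    by (simp only: power2_norm_eq_inner)
qed

lemma gram_pos_def_iff: "rank X = CARD('d) \<longleftrightarrow> pos_def (transpose X ** X)"
  for X :: "real^'d^'n"
proof -
  have "inj ((*v) X) \<longleftrightarrow> (\<forall>x. X *v x = 0 \<longrightarrow> x = 0)"
    by (rule linear_injective_0[OF matrix_vector_mul_linear])
  then show ?thesis
    unfolding full_rank_injective pos_def_def gram_form by (auto simp: matrix_transpose_mul)
qed

text \<open>A left inverse of the Gram matrix makes \<open>X\<close> injective. Stated through a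
  determinant, full rank is visibly an open condition.\<close>

lemma gram_det_iff: "rank X = CARD('d) \<longleftrightarrow> det (transpose X ** X) \<noteq> 0"
  for X :: "real^'d^'n"
proof
  assume "rank X = CARD('d)"
  then show "det (transpose X ** X) \<noteq> 0"
    using pos_def_invertible invertible_det_nz gram_pos_def_iff by blast
next
  assume "det (transpose X ** X) \<noteq> 0"
  then obtain B where B: "B ** (transpose X ** X) = mat 1"
    using invertible_det_nz invertible_left_inverse by blast
  have "x = 0" if "X *v x = 0" for x
  proof -
    have "x = (B ** (transpose X ** X)) *v x"
      by (simp add: B)
    also have "\<dots> = B *v (transpose X *v (X *v x))"
      by (simp add: matrix_vector_mul_assoc matrix_mul_assoc)
    finally show ?thesis
      by (simp add: that)
  qed
  then show "rank X = CARD('d)"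
    unfolding full_rank_injective linear_injective_0[OF matrix_vector_mul_linear] by blast
qed

lemma bundle_proj_nth: "bundle_proj X $ i $ j = X $ i \<bullet> X $ j"
  by (simp add: bundle_proj_def matrix_matrix_mult_def transpose_def inner_vec_def)

lemma pos_def_gram: "X \<in> total_space \<Longrightarrow> pos_def (transpose X ** X)"
  by (simp add: total_space_def gram_pos_def_iff)

lemma open_total_space: "open (total_space :: (real^'d^'n) set)"
proof -
  have eq: "total_space = {X :: real^'d^'n. det (transpose X ** X) \<noteq> 0} \<inter>
      (\<Inter>i\<in>UNIV. \<Inter>j\<in>UNIV. {X. 0 < X $ i \<bullet> X $ j} \<inter> {X. X $ i \<bullet> X $ j < 1})"
    by (auto simp: total_space_def gram_det_iff)
  moreover have "open {X :: real^'d^'n. det (transpose X ** X) \<noteq> 0}"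
    unfolding det_def matrix_matrix_mult_def transpose_def
    by (intro open_Collect_neq continuous_intros)
  ultimately show ?thesis
    unfolding eq by (intro open_INT open_Int ballI finite open_Collect_less continuous_intros)
qed

section \<open>Right multiplication by orthogonal matrices and horizontal vectors\<close>

lemma bundle_proj_orthogonal: "orthogonal_matrix Q \<Longrightarrow> bundle_proj (X ** Q) = bundle_proj X"
proof -
  assume "orthogonal_matrix Q"
  then have "X ** (Q ** transpose Q) ** transpose X = X ** transpose X"
    by (simp add: orthogonal_matrix_def)
  then show ?thesis
    by (simp add: bundle_proj_def matrix_transpose_mul matrix_mul_assoc)
qed

lemma gram_orthogonal: "transpose (X ** Q) ** (Z ** Q) = transpose Q ** (transpose X ** Z) ** Q"
  for X Z :: "real^'d^'n"
  by (simp add: matrix_transpose_mul matrix_mul_assoc)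

lemma total_space_orthogonal:
  assumes "X \<in> total_space" "orthogonal_matrix Q" shows "X ** Q \<in> total_space"
proof -
  have "(X ** Q) $ i \<bullet> (X ** Q) $ j = X $ i \<bullet> X $ j" for i j
    using bundle_proj_orthogonal[OF assms(2), of X] by (metis bundle_proj_nth)
  moreover have "det (transpose (X ** Q) ** (X ** Q)) \<noteq> 0"
    using assms unfolding gram_orthogonal det_mul
    by (auto simp: total_space_def gram_det_iff dest: det_orthogonal_matrix)
  ultimately show ?thesis
    using assms by (simp add: total_space_def gram_det_iff)
qed

text \<open>Congruence with \<open>Q\<close> preserves the symmetry of
  \<open>transpose X ** Z\<close>.\<close>

lemma horizontal_space_orthogonal:
  assumes "Z \<in> horizontal_space X" shows "Z ** Q \<in> horizontal_space (X ** Q)"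
proof -
  have "transpose (transpose X ** Z) = transpose X ** Z"
    using assms by (simp add: horizontal_space_def)
  then show ?thesis
    unfolding horizontal_space_def mem_Collect_eq gram_orthogonal
    by (simp add: matrix_transpose_mul matrix_mul_assoc)
qed

lemma horizontal_space_scaleR_iff:
  "c \<noteq> 0 \<Longrightarrow> c *\<^sub>R Z \<in> horizontal_space X \<longleftrightarrow> Z \<in> horizontal_space X"
  by (auto simp: horizontal_space_def matrix_mult.scaleR_right transpose_linear_simps)

lemma symmetric_mult_horizontal: "transpose Y = Y \<Longrightarrow> Y ** X \<in> horizontal_space X"
  by (simp add: horizontal_space_def matrix_transpose_mul matrix_mul_assoc)

text \<open>With the pseudo-inverse \<open>P = (q\<^sup>T q)\<^sup>-\<^sup>1 q\<^sup>T\<close>, take \<open>Y = u P + P\<^sup>T u\<^sup>T - P\<^sup>T (u\<^sup>T q) P\<close>.\<close>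

lemma horizontal_vector_as_symmetric_mult:
  assumes q: "q \<in> total_space" and u: "u \<in> horizontal_space q"
  obtains Y where "transpose Y = Y" "Y ** q = u"
proof -
  define K where "K = transpose q ** q"
  define P where "P = matrix_inv K ** transpose q"
  define Y where "Y = u ** P + transpose P ** transpose u - transpose P ** (transpose u ** q) ** P"
  have "invertible K"
    using q unfolding K_def by (intro pos_def_invertible pos_def_gram)
  then have Pq: "P ** q = mat 1"
    using matrix_inv_left[of K] by (simp add: P_def K_def flip: matrix_mul_assoc)
  have sym: "transpose q ** u = transpose u ** q"
    using u by (simp add: horizontal_space_def matrix_transpose_mul)
  have "transpose Y = Y"
    unfolding Y_def by (simp add: matrix_algebra sym[symmetric] add.commute)  moreover have "Y ** q = u"
  proof -
    have "Y ** q = u ** (P ** q) + transpose P ** transpose u ** q - transpose P ** (transpose u ** q) ** (P ** q)"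
      unfolding Y_def by (simp add: matrix_algebra)
    then show ?thesis
      by (simp add: Pq matrix_mul_assoc)
  qed
  ultimately show ?thesis
    using that by blast
qed

section \<open>Curvature\<close>

lemma connection_form_eq:
  assumes X: "X \<in> total_space" and W: "W \<in> skew_matrices"
    and eq: "(transpose X ** X) ** W + W ** (transpose X ** X) = transpose X ** Z - transpose Z ** X"
  shows "connection_form X Z = W"
  unfolding connection_form_def
proof (rule the_equality)
  show "W' = W" if "W' \<in> skew_matrices \<and> (transpose X ** X) ** W' + W' ** (transpose X ** X) =
        transpose X ** Z - transpose Z ** X" for W'
    using injD[OF lyapunov_inj[OF pos_def_gram[OF X]], of W' W] that eq by simp
qed (use W eq in simp)

text \<open>Horizontality says that \<open>transpose X ** H X\<close> equals its transpose on an
  open set; both sides are differentiated at \<open>q\<close> in the direction \<open>V\<close>, and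
  derivatives are unique.\<close>

lemma horizontal_field_derivative:
  assumes H: "horizontal_field H" and q: "q \<in> total_space"
    and D: "D = frechet_derivative H (at q) V"
  shows "transpose V ** H q + transpose q ** D = transpose (transpose V ** H q + transpose q ** D)"
proof -
  have "Ck_on (Suc 0) total_space H"
    using H unfolding horizontal_field_def smooth_on_def by blast
  then have H': "(H has_derivative frechet_derivative H (at q)) (at q)"
    using Ck_on_Suc_has_derivative q by blast
  have "((\<lambda>X. transpose X ** H X) has_derivative
      (\<lambda>V. transpose q ** frechet_derivative H (at q) V + transpose V ** H q)) (at q)"
    by (intro matrix_mult.FDERIV H' bounded_linear_imp_has_derivative bounded_linear_transpose)
  note d = this has_derivative_compose[OF this bounded_linear_imp_has_derivative[OF bounded_linear_transpose]]
  have "transpose (transpose X ** H X) = transpose X ** H X" if "X \<in> total_space" for X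
    using H that by (simp add: horizontal_field_def horizontal_space_def)
  then have "((\<lambda>X. transpose X ** H X) has_derivative
      (\<lambda>V. transpose (transpose q ** frechet_derivative H (at q) V + transpose V ** H q))) (at q)"
    by (intro has_derivative_transform_within_open[OF d(2) open_total_space q])
  from has_derivative_unique[OF this d(1)] show ?thesis
    unfolding D by (simp only: fun_eq_iff add.commute[of "transpose V ** H q"])
qed

text \<open>Differentiated horizontality of both fields eliminates their derivatives from the
  equation for the connection form of the bracket, leaving an expression in \<open>u\<close> and
  \<open>v\<close> alone. The curvature is thereby the solution of a Lyapunov equation, and the
  extending fields disappear from later arguments.\<close>

lemma curvature_equation:
  fixes q :: "real^'d^'n"
  assumes q: "q \<in> total_space" and u: "u \<in> horizontal_space q" and v: "v \<in> horizontal_space q"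
  defines "K \<equiv> transpose q ** q"
  shows "K ** curvature q u v + curvature q u v ** K = 2 *\<^sub>R (transpose u ** v - transpose v ** u)"
proof -
  have K: "pos_def K"
    unfolding K_def by (rule pos_def_gram[OF q])
  have "2 *\<^sub>R (transpose u ** v - transpose v ** u) \<in> skew_matrices"
    by (simp add: skew_matrices_def matrix_algebra scaleR_diff_right)
  then obtain W where W: "W \<in> skew_matrices" "K ** W + W ** K = 2 *\<^sub>R (transpose u ** v - transpose v ** u)"
    using lyapunov_skew_solution[OF K] by blast
  have val: "connection_form q (lie_bracket H1 H2 q) = - W"
    if "horizontal_field H1" "horizontal_field H2" "H1 q = u" "H2 q = v" for H1 H2
  proof (rule connection_form_eq[OF q])
    show "- W \<in> skew_matrices"
      using W(1) by (simp add: skew_matrices_def transpose_linear_simps)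
    define D1 where "D1 = frechet_derivative H1 (at q) v"
    define D2 where "D2 = frechet_derivative H2 (at q) u"
    have 1: "transpose v ** u + transpose q ** D1 = transpose u ** v + transpose D1 ** q"
      using horizontal_field_derivative[OF that(1) q D1_def] that(3) by (simp add: matrix_algebra)
    have 2: "transpose u ** v + transpose q ** D2 = transpose v ** u + transpose D2 ** q"
      using horizontal_field_derivative[OF that(2) q D2_def] that(4) by (simp add: matrix_algebra)
    have "transpose q ** (D2 - D1) - transpose (D2 - D1) ** q =
        - 2 *\<^sub>R (transpose u ** v - transpose v ** u)"
    proof -
      \<comment> \<open>Once the matrix products are named, the two symmetry relations leave only
        vector space algebra.\<close>
      have "x1 - x2 = - 2 *\<^sub>R (a - b)"
        if "b + d1 = a + d1'" "a + d2 = b + d2'" "x1 = d2 - d1" "x2 = d2' - d1'"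
        for a b d1 d2 d1' d2' x1 x2 :: "real^'d^'d"
      proof -
        have d': "d1' = b + d1 - a" "d2' = a + d2 - b"
          using that(1,2) by (simp_all add: eq_diff_eq add.commute)
        show ?thesis
          unfolding that(3,4) d' by (simp add: algebra_simps scaleR_2)
      qed
      from this[OF 1 2] show ?thesis
        by (simp add: matrix_algebra)
    qed
    then show "(transpose q ** q) ** - W + - W ** (transpose q ** q) =
        transpose q ** lie_bracket H1 H2 q - transpose (lie_bracket H1 H2 q) ** q"
      using that(3,4) arg_cong[OF W(2), of uminus] unfolding lie_bracket_def D1_def D2_def K_def
      by (simp add: matrix_mult.minus_left matrix_mult.minus_right)
  qed
  \<comment> \<open>Left multiplication by a fixed symmetric matrix is a linear field that is
    horizontal everywhere.\<close>
  have "\<exists>H. horizontal_field H \<and> H q = w" if w: "w \<in> horizontal_space q" for w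
  proof -
    obtain Y where Y: "transpose Y = Y" "Y ** q = w"
      using horizontal_vector_as_symmetric_mult[OF q w] .
    then have "horizontal_field (\<lambda>X. Y ** X)"
      unfolding horizontal_field_def
      by (auto intro!: smooth_on_bounded_linear open_total_space matrix_mult.bounded_linear_right
          symmetric_mult_horizontal)
    then show ?thesis
      using Y(2) by blast
  qed
  then obtain H1 H2 where H: "horizontal_field H1" "H1 q = u" "horizontal_field H2" "H2 q = v"
    using u v by blast
  have "curvature q u v = W"
    unfolding curvature_def
  proof (rule the_equality)
    show "\<exists>H1 H2. horizontal_field H1 \<and> horizontal_field H2 \<and> H1 q = u \<and> H2 q = v \<and>
        W = - connection_form q (lie_bracket H1 H2 q)"
      using H val[OF H(1,3,2,4)] by (intro exI[of _ H1] exI[of _ H2]) simp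
  qed (auto simp: val)
  then show ?thesis
    using W(2) by simp
qed

section \<open>Horizontal paths\<close>

text \<open>The velocity is the constant \<open>Y - X\<close>. Its product with the transposed point
  of the segment is a combination of the symmetric matrices \<open>X\<^sup>T X\<close>,
  \<open>Y\<^sup>T Y\<close> and \<open>X\<^sup>T Y\<close>.\<close>

lemma horizontal_path_linepath:
  fixes X Y :: "real^'d^'n"
  assumes "closed_segment X Y \<subseteq> total_space" "transpose (transpose X ** Y) = transpose X ** Y"
  shows "horizontal_path (linepath X Y)"
proof -
  have "Z \<in> horizontal_space (linepath X Y t)"
    if Z: "(linepath X Y has_vector_derivative Z) (at t within {0..1})" and t: "t \<in> {0..1}" for t Z
  proof -
    have "(linepath X Y has_vector_derivative (Y - X)) (at t within {0..1})"
      by (rule has_vector_derivative_linepath_within)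
    then have Z: "Z = Y - X"
      using Z t vector_derivative_unique_within[of t "{0..1}" "linepath X Y" Z "Y - X"]
      by (simp add: trivial_limit_within islimpt_Icc)
    have "transpose Y ** X = transpose X ** Y"
      using assms(2) by (simp add: matrix_transpose_mul)
    then show ?thesis
      unfolding Z horizontal_space_def linepath_def
      by (simp add: matrix_algebra algebra_simps)
  qed
  then show ?thesis
    using assms(1) unfolding horizontal_path_def
    by (auto simp: piecewise_smooth_path_linepath)
qed

lemma horizontal_path_orthogonal:
  fixes g :: "real \<Rightarrow> real^'d^'n"
  assumes g: "horizontal_path g" and Q: "orthogonal_matrix Q"
  shows "horizontal_path (\<lambda>t. g t ** Q)"
proof -
  have "piecewise_smooth_path (\<lambda>t. g t ** Q)"
    using g piecewise_smooth_path_bounded_linear[OF matrix_mult.bounded_linear_left[of Q], of g]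
    unfolding horizontal_path_def by blast
  moreover have "path_image (\<lambda>t. g t ** Q) \<subseteq> total_space"
    using g total_space_orthogonal[OF _ Q] unfolding horizontal_path_def path_image_def by auto
  moreover have "Z \<in> horizontal_space (g t ** Q)"
    if Z: "((\<lambda>t. g t ** Q) has_vector_derivative Z) (at t within {0..1})" and t: "t \<in> {0..1}" for t Z
  proof -
    have QQ: "Q ** transpose Q = mat 1" "transpose Q ** Q = mat 1"
      using Q by (auto simp: orthogonal_matrix_def)
    \<comment> \<open>Only the translated path is known to be differentiable at \<open>t\<close>;
      multiplying back by \<open>transpose Q\<close> transfers this to \<open>g\<close>.\<close>
    have "((\<lambda>t. g t ** Q ** transpose Q) has_vector_derivative Z ** transpose Q) (at t within {0..1})"
      by (rule bounded_linear.has_vector_derivative[OF matrix_mult.bounded_linear_left Z])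
    then have "(g has_vector_derivative Z ** transpose Q) (at t within {0..1})"
      by (simp add: QQ flip: matrix_mul_assoc)
    then have "Z ** transpose Q \<in> horizontal_space (g t)"
      using g t unfolding horizontal_path_def by blast
    from horizontal_space_orthogonal[OF this, of Q] show ?thesis
      by (simp add: QQ flip: matrix_mul_assoc)
  qed
  ultimately show ?thesis
    unfolding horizontal_path_def by blast
qed

text \<open>On part of its domain \<open>h\<close> runs through \<open>g\<close> at speed
  \<open>a\<close>. By the chain rule the velocity of \<open>g\<close> is that of \<open>h\<close>
  divided by \<open>a\<close>, and horizontality ignores nonzero factors. Reversal and both halves
  of a join are instances.\<close>

lemma horizontal_velocity_affine:
  fixes g h :: "real \<Rightarrow> real^'d^'n"
  assumes g: "\<And>Z. (g has_vector_derivative Z) (at (a * t + b) within {0..1}) \<Longrightarrow> Z \<in> horizontal_space (g (a * t + b))"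
    and a: "a \<noteq> 0" and h: "(h has_vector_derivative Z) (at t within {0..1})"
    and t: "a * t + b \<in> {0..1}"
    and eq: "\<And>s. s \<in> {0..1} \<Longrightarrow> (s - b) / a \<in> {0..1} \<and> h ((s - b) / a) = g s"
  shows "Z \<in> horizontal_space (h t)"
proof -
  have t': "(a * t + b - b) / a = t"
    using a by simp
  have "((\<lambda>s. (s - b) / a) has_vector_derivative (1 / a)) (at (a * t + b) within {0..1})"
    unfolding has_real_derivative_iff_has_vector_derivative[symmetric]
    using a by (auto intro!: derivative_eq_intros)
  moreover have "(h has_vector_derivative Z) (at ((a * t + b - b) / a) within (\<lambda>s. (s - b) / a) ` {0..1})"
    unfolding t' by (rule has_vector_derivative_within_subset[OF h]) (use eq in auto)
  ultimately have "(h \<circ> (\<lambda>s. (s - b) / a) has_vector_derivative (1 / a) *\<^sub>R Z) (at (a * t + b) within {0..1})"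
    by (rule vector_diff_chain_within)
  then have "(g has_vector_derivative (1 / a) *\<^sub>R Z) (at (a * t + b) within {0..1})"
    by (rule has_vector_derivative_transform[rotated 2]) (use eq t in auto)
  from g[OF this] have "Z \<in> horizontal_space (g (a * t + b))"
    using a by (simp add: horizontal_space_scaleR_iff)
  then show ?thesis
    using eq[OF t] t' by simp
qed

lemma horizontal_path_reversepath:
  assumes "horizontal_path g" shows "horizontal_path (reversepath g)"
proof -
  have "Z \<in> horizontal_space (reversepath g t)"
    if Z: "(reversepath g has_vector_derivative Z) (at t within {0..1})" and t: "t \<in> {0..1}" for t Z
    by (rule horizontal_velocity_affine[where g = g and a = "-1" and b = 1 and t = t, OF _ _ Z])
      (use assms t in \<open>auto simp: horizontal_path_def reversepath_def\<close>)
  then show ?thesis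
    using assms unfolding horizontal_path_def by (auto simp: piecewise_smooth_path_reversepath)
qed

lemma horizontal_path_join:
  assumes g1: "horizontal_path g1" and g2: "horizontal_path g2" and fs: "pathfinish g1 = pathstart g2"
  shows "horizontal_path (g1 +++ g2)"
proof -
  have "Z \<in> horizontal_space ((g1 +++ g2) t)"
    if Z: "(g1 +++ g2 has_vector_derivative Z) (at t within {0..1})" and t: "t \<in> {0..1}" for t Z
  proof (cases "t \<le> 1/2")
    \<comment> \<open>A derivative of the join at 1/2, if there is one, is also the one-sided
      derivative along \<open>g1\<close>, so the break point belongs to this case.\<close>
    case True
    show ?thesis
      by (rule horizontal_velocity_affine[where g = g1 and a = 2 and b = 0 and t = t, OF _ _ Z])
        (use g1 True t in \<open>auto simp: horizontal_path_def joinpaths_def\<close>)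
  next
    case False
    have eq: "(g1 +++ g2) ((s - (- 1)) / 2) = g2 s" if "s \<in> {0..1}" for s
      using that fs by (cases "s = 0") (auto simp: joinpaths_def pathfinish_def pathstart_def field_simps)
    show ?thesis
      by (rule horizontal_velocity_affine[where g = g2 and a = 2 and b = "-1" and t = t, OF _ _ Z _ conjI[OF _ eq]])
        (use g2 False t in \<open>auto simp: horizontal_path_def field_simps\<close>)
  qed
  then show ?thesis
    using assms piecewise_smooth_path_join[OF _ _ fs] path_image_join_subset[of g1 g2]
    unfolding horizontal_path_def by auto
qed

section \<open>Holonomy of contractible loops has determinant one\<close>

definition plucker :: "real^'d^'n \<Rightarrow> real^('d \<Rightarrow> 'n)" where
  "plucker X = (\<chi> f. det (\<chi> i. X $ f i))"

text \<open>This is \<open>v v\<^sup>T\<close>, which determines \<open>v\<close> up to sign: the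
  double cover that detects the sign of a determinant.\<close>

definition outer_square :: "real^'k \<Rightarrow> real^'k^'k" where
  "outer_square v = (\<chi> i j. v $ i * v $ j)"

lemma plucker_mult: "plucker (X ** Q) = det Q *\<^sub>R plucker X" for X :: "real^'d^'n"
proof -
  have "(\<chi> i. (X ** Q) $ f i) = (\<chi> i. X $ f i) ** Q" for f :: "'d \<Rightarrow> 'n"
    by (simp add: vec_eq_iff matrix_matrix_mult_def)
  then show ?thesis
    unfolding plucker_def by (subst vec_eq_iff) (simp add: det_mul)
qed

text \<open>A product of two maximal minors of \<open>X\<close> is the determinant of a submatrix of
  \<open>X X\<^sup>T\<close>, hence a function of the base point.\<close>

lemma outer_square_plucker:
  "outer_square (plucker X) = (\<chi> f g. det (\<chi> i j. bundle_proj X $ f i $ g j))"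
proof -
  have "det (\<chi> i j. bundle_proj X $ f i $ g j) = det (\<chi> i. X $ f i) * det (\<chi> i. X $ g i)" for f g
  proof -
    have "(\<chi> i j. bundle_proj X $ f i $ g j) = (\<chi> i. X $ f i) ** transpose (\<chi> i. X $ g i)"
      by (simp add: vec_eq_iff bundle_proj_nth matrix_matrix_mult_def transpose_def inner_vec_def)
    then show ?thesis
      by (simp add: det_mul)
  qed
  then show ?thesis
    by (simp add: outer_square_def plucker_def)
qed

text \<open>Full rank makes the rows span, so a basis can be chosen among them, and the
  corresponding minor does not vanish.\<close>

lemma plucker_nonzero:
  fixes X :: "real^'d^'n"
  assumes "X \<in> total_space" shows "plucker X \<noteq> 0"
proof -
  have "inj ((*v) X)"
    using assms by (simp add: total_space_def full_rank_injective)
  then have "\<exists>B. B ** X = mat 1"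
    by (simp add: matrix_left_invertible_injective)
  then have sp: "span (rows X) = UNIV"
    by (simp add: matrix_left_invertible_span_rows span_vec_eq)
  obtain B where B: "B \<subseteq> rows X" "independent B" "rows X \<subseteq> span B"
    using maximal_independent_subset[of "rows X"] by blast
  have spB: "span B = UNIV"
    using sp B(3) by (metis span_mono span_span top.extremum_uniqueI)
  then have "card B = CARD('d)"
    using B(2) by (metis basis_card_eq_dim dim_UNIV DIM_cart DIM_real mult.right_neutral subset_UNIV)
  \<comment> \<open>The basis has as many elements as there are columns, so the column type can
    index it.\<close>
  then obtain b where b: "bij_betw b (UNIV :: 'd set) B"
    using B(2) finiteI_independent finite_same_card_bij[of "UNIV :: 'd set" B] by auto
  have "\<forall>i. \<exists>k. b i = X $ k"
    using b B(1) unfolding bij_betw_def rows_def row_def by (force simp: vec_lambda_eta)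
  then obtain f where f: "\<And>i. b i = X $ f i"
    by metis
  have "rows (\<chi> i. X $ f i) = B"
    using b f unfolding bij_betw_def rows_def row_def by (auto simp: vec_lambda_eta)
  then have "\<exists>B'. B' ** (\<chi> i. X $ f i) = mat 1"
    using spB by (simp add: matrix_left_invertible_span_rows span_vec_eq)
  then have "det (\<chi> i. X $ f i) \<noteq> 0"
    using invertible_det_nz invertible_left_inverse by blast
  then have "plucker X $ f \<noteq> 0"
    by (simp add: plucker_def)
  then show ?thesis
    by (metis zero_index)
qed

text \<open>Over the matrices \<open>M\<close> of the image with
  \<open>0 < v0 \<bullet> (M *v v0)\<close> the preimage splits into the half-spaces where
  \<open>w \<bullet> v0\<close> is positive and negative, and each is mapped
  homeomorphically.\<close>

lemma covering_space_outer_square: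
  "covering_space (- {0}) outer_square (outer_square ` (- {0 :: real^'k}))"
proof
  show cont: "continuous_on (- {0}) (outer_square :: real^'k \<Rightarrow> _)"
    unfolding outer_square_def by (intro continuous_intros)
  fix M assume "M \<in> outer_square ` (- {0 :: real^'k})"
  then obtain v0 where v0: "v0 \<noteq> 0" "M = outer_square v0"
    by auto
  have mv: "outer_square w *v v0 = (w \<bullet> v0) *\<^sub>R w" for w :: "real^'k"
    by (simp add: vec_eq_iff outer_square_def matrix_vector_mult_def inner_vec_def sum_distrib_left sum_distrib_right ac_simps)
  define T where "T = outer_square ` (- {0}) \<inter> {M. 0 < v0 \<bullet> (M *v v0)}"
  \<comment> \<open>For \<open>M = w w\<^sup>T\<close> one has
    \<open>M v0 = (w \<bullet> v0) w\<close> and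
    \<open>v0 \<bullet> M v0 = (w \<bullet> v0)\<^sup>2\<close>, so the quotient recovers
    \<open>w\<close> up to the sign of \<open>w \<bullet> v0\<close>.\<close>
  define r where "r M = (1 / sqrt (v0 \<bullet> (M *v v0))) *\<^sub>R (M *v v0)" for M
  define V where "V s = {w. 0 < s * (w \<bullet> v0)}" for s :: real
  have memT: "outer_square w \<in> T \<longleftrightarrow> w \<bullet> v0 \<noteq> 0" for w
  proof -
    have "w \<noteq> 0" if "w \<bullet> v0 \<noteq> 0"
      using that by auto
    then show ?thesis
      by (auto simp: T_def mv inner_commute zero_less_mult_iff) 
  qed
  have r: "r (outer_square w) = sgn (w \<bullet> v0) *\<^sub>R w" if "w \<bullet> v0 \<noteq> 0" for w
  proof -
    have "sqrt (v0 \<bullet> (outer_square w *v v0)) = \<bar>w \<bullet> v0\<bar>"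
      by (simp add: mv inner_commute)
    then show ?thesis
      using that unfolding r_def by (simp add: mv sgn_real_def)
  qed
  have contr: "continuous_on T r"
    unfolding r_def T_def
    by (auto intro!: continuous_intros matrix_vector_mult_linear_continuous_on
        simp: matrix_vector_mult_def)
  have "openin (top_of_set (outer_square ` (- {0}))) T"
    unfolding T_def
    by (intro openin_open_Int open_Collect_less) (auto simp: matrix_vector_mult_def intro!: continuous_intros)
  moreover have "M \<in> T"
    using v0 memT[of v0] by simp
  moreover have "\<Union>(V ` {1, -1}) = - {0} \<inter> outer_square -` T"
    by (auto simp: memT neq_iff V_def)
  moreover have "openin (top_of_set (- {0})) (V s)" for s
    unfolding V_def
    by (intro open_subset open_Collect_less continuous_intros) auto
  moreover have "pairwise disjnt (V ` {1, -1})"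
    by (auto simp: pairwise_insert disjnt_def V_def)
  moreover have "homeomorphism (V s) T outer_square (\<lambda>M. s *\<^sub>R r M)" if s: "s \<in> {1, -1}" for s
    unfolding homeomorphism_def
  proof (intro conjI ballI)
    show "continuous_on (V s) outer_square"
      by (rule continuous_on_subset[OF cont]) (auto simp: V_def)
    have VT: "outer_square w \<in> T" "s *\<^sub>R r (outer_square w) = w" if "w \<in> V s" for w
      using that s by (auto simp: V_def memT r)
    have ex: "\<exists>w\<in>V s. M = outer_square w" if M: "M \<in> T" for M
    proof -
      obtain w where w: "M = outer_square w" "w \<bullet> v0 \<noteq> 0"
        using M memT by (auto simp: T_def)
      have "outer_square (- w) = outer_square w"
        by (simp add: outer_square_def)
      then show ?thesis
        using w s by (intro bexI[of _ "(s * sgn (w \<bullet> v0)) *\<^sub>R w"]) (auto simp: V_def sgn_real_def)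
    qed
    show "outer_square ` V s = T" "(\<lambda>M. s *\<^sub>R r M) ` T = V s"
      using ex VT by force+
    show "s *\<^sub>R r (outer_square w) = w" if "w \<in> V s" for w
      using VT that by simp
    show "outer_square (s *\<^sub>R r M) = M" if "M \<in> T" for M
      using ex[OF that] VT by auto
  qed (intro continuous_intros contr)
  then have "\<forall>u\<in>V ` {1, -1}. \<exists>q. homeomorphism u T outer_square q"
    by blast
  ultimately show "\<exists>T. M \<in> T \<and> openin (top_of_set (outer_square ` (- {0}))) T \<and>
      (\<exists>v. \<Union> v = - {0} \<inter> outer_square -` T \<and> (\<forall>u\<in>v. openin (top_of_set (- {0})) u) \<and>
        pairwise disjnt v \<and> (\<forall>u\<in>v. \<exists>q. homeomorphism u T outer_square q))"
    by (intro exI[of _ T] conjI exI[of _ "V ` {1, -1}"]) blast+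
qed simp

lemma restricted_holonomy_subset:
  fixes Xp :: "real^'d^'n"
  assumes "Xp \<in> total_space" "Q \<in> restricted_holonomy p Xp"
  shows "rotation_matrix Q"
proof -
  obtain \<gamma> g where \<gamma>: "contractible_loop TYPE('d) p \<gamma>" and Q: "orthogonal_matrix Q"
    and g: "horizontal_lift \<gamma> g" "pathstart g = Xp" "pathfinish g = Xp ** Q"
    using assms(2) unfolding restricted_holonomy_def has_holonomy_def by blast
  \<comment> \<open>The composite of \<open>plucker\<close> and \<open>outer_square\<close> descends
    to this map on the base, which sends loops there to loops below the double cover.\<close>
  define \<Theta> :: "real^'n^'n \<Rightarrow> real^('d \<Rightarrow> 'n)^('d \<Rightarrow> 'n)" where
    "\<Theta> G = (\<chi> f g. det (\<chi> i j. G $ f i $ g j))" for G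
  have \<Theta>: "\<Theta> (bundle_proj X) = outer_square (plucker X)" for X :: "real^'d^'n"
    unfolding \<Theta>_def by (rule outer_square_plucker[symmetric])
  have cont\<Theta>: "continuous_on S \<Theta>" for S
    unfolding \<Theta>_def det_def by (auto intro!: continuous_intros)
  have contP: "continuous_on S (plucker :: real^'d^'n \<Rightarrow> _)" for S
    unfolding plucker_def det_def by (auto intro!: continuous_intros)
  have im: "\<Theta> ` base_space TYPE('d) \<subseteq> outer_square ` (- {0})"
    unfolding base_space_def by (auto simp: \<Theta> intro!: imageI dest: plucker_nonzero)
  have path_g: "path g" and g_tot: "\<And>t. t \<in> {0..1} \<Longrightarrow> g t \<in> total_space"
    and proj: "\<And>t. t \<in> {0..1} \<Longrightarrow> bundle_proj (g t) = \<gamma> t"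
    using g(1) unfolding horizontal_lift_def horizontal_path_def piecewise_smooth_path_def
    by (auto simp: path_image_def)
  have p: "p = bundle_proj Xp"
    using \<gamma> proj[of 0] g(2) by (simp add: contractible_loop_def pathstart_def)
  have hom: "homotopic_paths (outer_square ` (- {0})) (\<Theta> \<circ> \<gamma>) (\<Theta> \<circ> linepath p p)"
    by (rule homotopic_paths_continuous_image[OF _ cont\<Theta>])
      (use \<gamma> im in \<open>auto simp: contractible_loop_def\<close>)
  \<comment> \<open>The coordinates of the lift \<open>g\<close> and the constant path lift
    homotopic loops from the same starting point, so monodromy gives them the same end
    point.\<close>
  have "pathfinish (plucker \<circ> g) = pathfinish (\<lambda>t. plucker Xp)"
  proof (rule covering_space_monodromy[OF covering_space_outer_square _ _ _ _ hom])
    show "path (\<Theta> \<circ> \<gamma>)" "path_image (\<Theta> \<circ> \<gamma>) \<subseteq> outer_square ` (- {0})"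
      "path (\<Theta> \<circ> linepath p p)" "path_image (\<Theta> \<circ> linepath p p) \<subseteq> outer_square ` (- {0})"
      using homotopic_paths_imp_path[OF hom] homotopic_paths_imp_subset[OF hom] by auto
    show "path (plucker \<circ> g)"
      using path_g contP path_continuous_image by blast
    show "path_image (plucker \<circ> g) \<subseteq> - {0}"
      using plucker_nonzero[OF g_tot] by (auto simp: path_image_def)
    show "outer_square ((plucker \<circ> g) t) = (\<Theta> \<circ> \<gamma>) t" if "t \<in> {0..1}" for t
      using that by (simp add: \<Theta>[symmetric] proj)
    show "path (\<lambda>t. plucker Xp)"
      by (simp add: path_def)
    show "path_image (\<lambda>t. plucker Xp) \<subseteq> - {0}"
      using plucker_nonzero[OF assms(1)] by (auto simp: path_image_def)
    show "outer_square (plucker Xp) = (\<Theta> \<circ> linepath p p) t" if "t \<in> {0..1}" for t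
      by (simp add: \<Theta>[symmetric] p linepath_refl)
    show "pathstart (plucker \<circ> g) = pathstart (\<lambda>t. plucker Xp)"
      using g(2) by (simp add: pathstart_def)
  qed
  then have "det Q *\<^sub>R plucker Xp = plucker Xp"
    using g(3) by (simp add: pathfinish_def plucker_mult)
  then have "det Q *\<^sub>R plucker Xp = 1 *\<^sub>R plucker Xp"
    by simp
  then have "det Q = 1"
    using plucker_nonzero[OF assms(1)] by (simp only: scaleR_cancel_right) simp
  then show ?thesis
    using Q by (simp add: rotation_matrix_def)
qed

section \<open>Generating the rotation group\<close>

text \<open>Householder reflection in the hyperplane orthogonal to \<open>w\<close>; division by
  zero turns it into the identity for \<open>w = 0\<close>.\<close>

definition reflection_matrix :: "real^'d \<Rightarrow> real^'d^'d" where
  "reflection_matrix w = (\<chi> i j. (if i = j then 1 else 0) - 2 / (w \<bullet> w) * (w $ i * w $ j))"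

lemma reflection_matrix_vector:
  "reflection_matrix w *v v = v - (2 * (w \<bullet> v) / (w \<bullet> w)) *\<^sub>R w"
proof -
  have "(\<Sum>j\<in>UNIV. ((if i = j then 1 else 0) - 2 / (w \<bullet> w) * (w $ i * w $ j)) * v $ j) =
      v $ i - 2 / (w \<bullet> w) * (\<Sum>j\<in>UNIV. w $ j * v $ j) * w $ i" for i
  proof -
    have "(\<Sum>j\<in>UNIV. ((if i = j then 1 else 0) - 2 / (w \<bullet> w) * (w $ i * w $ j)) * v $ j) =
       (\<Sum>j\<in>UNIV. if i = j then v $ j else 0) - (\<Sum>j\<in>UNIV. 2 / (w \<bullet> w) * w $ i * (w $ j * v $ j))"
      unfolding sum_subtractf[symmetric] by (intro sum.cong refl) (simp add: algebra_simps)
    also have "\<dots> = v $ i - 2 / (w \<bullet> w) * w $ i * (\<Sum>j\<in>UNIV. w $ j * v $ j)"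
      unfolding sum_distrib_left[symmetric] by simp
    finally show ?thesis
      by (simp only: mult.assoc mult.commute[of "w $ i"])
  qed
  then show ?thesis
    by (simp add: vec_eq_iff reflection_matrix_def matrix_vector_mult_def inner_vec_def)
qed

lemma reflection_matrix_symmetric: "transpose (reflection_matrix w) = reflection_matrix w"
  by (simp add: reflection_matrix_def transpose_def vec_eq_iff ac_simps)

lemma reflection_matrix_involution:
  assumes "w \<noteq> 0" shows "reflection_matrix w ** reflection_matrix w = mat 1"
proof -
  have "reflection_matrix w *v (reflection_matrix w *v x) = x" for x
    using assms by (simp add: reflection_matrix_vector inner_diff_right)
  then show ?thesis
    by (simp add: matrix_eq matrix_vector_mul_assoc[symmetric])
qed

lemma orthogonal_reflection_matrix: "w \<noteq> 0 \<Longrightarrow> orthogonal_matrix (reflection_matrix w)"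
  by (simp add: orthogonal_matrix reflection_matrix_symmetric reflection_matrix_involution)

lemma reflection_matrix_scaleR: "c \<noteq> 0 \<Longrightarrow> reflection_matrix (c *\<^sub>R w) = reflection_matrix w"
  by (simp add: reflection_matrix_def vec_eq_iff power2_eq_square)

lemma det_reflection_axis: "det (reflection_matrix (axis k 1 :: real^'d)) = - 1"
proof -
  have nth: "reflection_matrix (axis k 1 :: real^'d) $ i $ j = (if i = j then if i = k then - 1 else 1 else 0)" for i j
    by (cases "i = k"; cases "j = k") (simp_all add: reflection_matrix_def axis_nth inner_axis_axis, simp_all add: axis_def)
  have "det (reflection_matrix (axis k 1 :: real^'d)) = (\<Prod>i\<in>UNIV. if i = k then - 1 else 1)"
    by (subst det_diagonal) (simp_all add: nth)
  then show ?thesis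
    by simp
qed

text \<open>Collects the properties through which the holonomy group enters the final generation
  argument.\<close>

locale near_identity_monoid =
  fixes H :: "(real^'d^'d) set" and e :: real
  assumes mult: "A \<in> H \<Longrightarrow> B \<in> H \<Longrightarrow> A ** B \<in> H"
    and e: "0 < e"
    and near: "orthogonal_matrix Q \<Longrightarrow> dist Q (mat 1) < e \<Longrightarrow> Q \<in> H"
    and rotation: "A \<in> H \<Longrightarrow> rotation_matrix A"
begin

lemma mat_1_in: "mat 1 \<in> H"
  using e by (intro near) (auto simp: orthogonal_matrix_id)

text \<open>Uniform continuity cuts the path into pieces whose increments are close to the identity,
  hence in \<open>H\<close>; their product telescopes.\<close>

lemma path_increment_in:
  fixes \<phi> :: "real \<Rightarrow> real^'d^'d"
  assumes cont: "continuous_on {0..1} \<phi>" and orth: "\<And>x. x \<in> {0..1} \<Longrightarrow> orthogonal_matrix (\<phi> x)"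
  shows "\<phi> 1 ** transpose (\<phi> 0) \<in> H"
proof -
  \<comment> \<open>The increment as a function of both parameters: it is the identity on the
    diagonal, and uniform continuity on the square keeps it within \<open>e\<close> of the identity
    nearby.\<close>
  define \<psi> where "\<psi> z = \<phi> (fst z) ** transpose (\<phi> (snd z))" for z
  have "continuous_on ({0..1} \<times> {0..1}) \<psi>"
    unfolding \<psi>_def
    by (intro matrix_mult.continuous_on bounded_linear.continuous_on[OF bounded_linear_transpose]
        continuous_on_compose2[OF cont] continuous_intros) auto
  then have "uniformly_continuous_on ({0..1} \<times> {0..1}) \<psi>"
    by (intro compact_uniformly_continuous compact_Times) auto
  then obtain d where d: "0 < d"
    "\<And>z z'. z \<in> {0..1} \<times> {0..1} \<Longrightarrow> z' \<in> {0..1} \<times> {0..1} \<Longrightarrow> dist z' z < d \<Longrightarrow> dist (\<psi> z') (\<psi> z) < e"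
    using e unfolding uniformly_continuous_on_def by metis
  obtain N where N: "1 / real (Suc N) < d"
    using nat_approx_posE[OF d(1)] by auto
  define n where "n = Suc N"
  have n: "0 < n" "1 / real n < d"
    using N by (auto simp: n_def)
  have step: "\<phi> y ** transpose (\<phi> x) \<in> H" if "x \<in> {0..1}" "y \<in> {0..1}" "\<bar>y - x\<bar> < d" for x y
  proof (rule near)
    show "orthogonal_matrix (\<phi> y ** transpose (\<phi> x))"
      using orth that by (simp add: orthogonal_matrix_mul)
    have "dist (\<psi> (y, x)) (\<psi> (x, x)) < e"
      using that by (intro d(2)) (auto simp: dist_Pair_Pair dist_real_def)
    moreover have "\<psi> (x, x) = mat 1"
      using orth[OF that(1)] by (simp add: \<psi>_def orthogonal_matrix_def)
    ultimately show "dist (\<phi> y ** transpose (\<phi> x)) (mat 1) < e"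
      by (simp add: \<psi>_def)
  qed
  have "\<phi> (real k / real n) ** transpose (\<phi> 0) \<in> H" if "k \<le> n" for k
    using that
  proof (induction k)
    case 0
    then show ?case
      using mat_1_in orth[of 0] by (simp add: orthogonal_matrix_def)
  next
    case (Suc k)
    let ?a = "real k / real n" and ?b = "real (Suc k) / real n"
    have ab: "?a \<in> {0..1}" "?b \<in> {0..1}" "\<bar>?b - ?a\<bar> < d"
      using Suc.prems n by (auto simp: diff_divide_distrib[symmetric])
    have "(\<phi> ?b ** transpose (\<phi> ?a)) ** (\<phi> ?a ** transpose (\<phi> 0)) \<in> H"
      using mult[OF step[OF ab] Suc.IH] Suc.prems by simp
    also have "(\<phi> ?b ** transpose (\<phi> ?a)) ** (\<phi> ?a ** transpose (\<phi> 0)) =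
        \<phi> ?b ** (transpose (\<phi> ?a) ** \<phi> ?a) ** transpose (\<phi> 0)"
      by (simp add: matrix_mul_assoc)
    finally show ?case
      using orth[OF ab(1)] by (simp add: orthogonal_matrix_def)
  qed
  from this[of n] show ?thesis
    using n by simp
qed

text \<open>Moving the normal vector along the segment from \<open>b\<close> to \<open>a\<close>
  gives a path of reflections whose increment is the product, each reflection being its own
  transpose. If the segment meets 0, then \<open>a\<close> and \<open>b\<close> are parallel and the
  product is the identity.\<close>

lemma two_reflections_in:
  assumes a: "a \<noteq> 0" and b: "b \<noteq> 0"
  shows "reflection_matrix a ** reflection_matrix b \<in> H"
proof (cases "0 \<in> closed_segment b a")
  case True
  then obtain u where u: "(1 - u) *\<^sub>R b + u *\<^sub>R a = 0"
    by (auto simp: closed_segment_def)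
  then have "u \<noteq> 0"
    using b by auto
  then have "a = (1 / u) *\<^sub>R (u *\<^sub>R a)"
    by simp
  also have "u *\<^sub>R a = - ((1 - u) *\<^sub>R b)"
    using u by (simp add: eq_neg_iff_add_eq_0 add.commute)
  finally have ab: "a = (- ((1 - u) / u)) *\<^sub>R b"
    by simp
  then have "- ((1 - u) / u) \<noteq> 0"
    using a by auto
  then have "reflection_matrix a = reflection_matrix b"
    using reflection_matrix_scaleR ab by metis
  then show ?thesis
    using mat_1_in reflection_matrix_involution[OF b] by simp
next
  case False
  have nz: "linepath b a x \<noteq> 0" if "x \<in> {0..1}" for x
    using False linepath_in_path[OF that, of b a] by auto
  have "continuous_on {0..1} (\<lambda>x. reflection_matrix (linepath b a x))"
    unfolding reflection_matrix_def
    by (intro continuous_on_vec_lambda continuous_intros continuous_on_linepath) (use nz in auto)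
  from path_increment_in[OF this orthogonal_reflection_matrix[OF nz]] show ?thesis
    by (simp add: reflection_matrix_symmetric linepath_0' linepath_1')
qed

text \<open>Cartan--Dieudonne: each reflection in \<open>Q e\<^sub>j - e\<^sub>j\<close> fixes one more basis vector.\<close>

lemma rotation_in:
  assumes Q: "rotation_matrix Q" shows "Q \<in> H"
proof -
  \<comment> \<open>A fixed reflection in an arbitrary coordinate hyperplane; it represents the
    component of determinant -1.\<close>
  define \<rho> where "\<rho> = reflection_matrix (axis (SOME k. True) 1 :: real^'d)"
  have \<rho>: "\<rho> ** \<rho> = mat 1" "det \<rho> = - 1"
    by (simp_all add: \<rho>_def reflection_matrix_involution axis_eq_0_iff det_reflection_axis)
  \<comment> \<open>The set \<open>F\<close> contains all indices of basis vectors that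
    \<open>Q\<close> may still move; the alternative records the parity of the number of
    reflections.\<close>
  have "Q \<in> H \<or> (\<exists>h\<in>H. Q = \<rho> ** h)"
    if "finite F" "orthogonal_matrix Q" "\<And>i. i \<notin> F \<Longrightarrow> Q *v axis i 1 = axis i 1" for F and Q :: "real^'d^'d"
    using that
  proof (induction F arbitrary: Q rule: finite_induct)
    case empty
    then have "Q = mat 1"
      by (auto simp: vec_eq_iff matrix_vector_mul_component mat_def axis_def inner_axis
          matrix_vector_mult_def if_distrib cong: if_cong)
    then show ?case
      using mat_1_in by simp
  next
    case (insert j F)
    define w where "w = Q *v axis j 1 - axis j 1"
    have pres: "(Q *v x) \<bullet> (Q *v y) = x \<bullet> y" for x y
    proof -
      have "(Q *v x) \<bullet> (Q *v y) = (transpose Q *v (Q *v x)) \<bullet> y"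
        by (rule inner_matrix_mult_vector)
      also have "\<dots> = x \<bullet> y"
        using insert.prems(1) by (simp only: matrix_vector_mul_assoc orthogonal_matrix matrix_vector_mul_lid)
      finally show ?thesis .
    qed
    show ?case
    proof (cases "w = 0")
      case True
      then show ?thesis
        using insert by (metis insertE right_minus_eq w_def)
    next
      case False
      define Q' where "Q' = reflection_matrix w ** Q"
      have "orthogonal_matrix Q'"
        unfolding Q'_def using insert.prems(1) orthogonal_reflection_matrix[OF False]
        by (rule orthogonal_matrix_mul[rotated])
      moreover have "Q' *v axis i 1 = axis i 1" if "i \<notin> F" for i
      proof (cases "i = j")
        case True
        \<comment> \<open>Since \<open>Q *v axis j 1\<close> and \<open>axis j 1\<close> have equal
          length, the reflection in their difference carries the first to the second.\<close>
        have "w \<bullet> w = 2 * (w \<bullet> (Q *v axis j 1))"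
          using pres[of "axis j 1" "axis j 1"]
          by (simp add: w_def inner_diff_left inner_diff_right inner_commute)
        moreover have "w \<bullet> w / (w \<bullet> w) = 1"
          using False by simp
        ultimately have "2 * (w \<bullet> (Q *v axis j 1)) / (w \<bullet> w) = 1"
          by simp
        then have "Q' *v axis j 1 = Q *v axis j 1 - 1 *\<^sub>R w"
          by (simp only: Q'_def matrix_vector_mul_assoc[symmetric] reflection_matrix_vector)
        then show ?thesis
          using True by (simp add: w_def)
      next
        case i: False
        then have fixed: "Q *v axis i 1 = axis i 1"
          using insert.prems(2) that by auto
        \<comment> \<open>Vectors already fixed are orthogonal to \<open>w\<close>, so the
          reflection leaves them fixed.\<close>
        have "w \<bullet> axis i 1 = 0"
          using pres[of "axis j 1" "axis i 1"] by (simp add: w_def inner_diff_left fixed)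
        then show ?thesis
          by (simp add: Q'_def matrix_vector_mul_assoc[symmetric] reflection_matrix_vector fixed)
      qed
      ultimately have IH: "Q' \<in> H \<or> (\<exists>h\<in>H. Q' = \<rho> ** h)"
        by (rule insert.IH)
      have Q: "Q = reflection_matrix w ** Q'"
        by (simp add: Q'_def matrix_mul_assoc reflection_matrix_involution[OF False])
      have in_H: "reflection_matrix w ** \<rho> \<in> H" "\<rho> ** reflection_matrix w \<in> H"
        using two_reflections_in False by (simp_all add: \<rho>_def axis_eq_0_iff)
      from IH show ?thesis
      proof
        assume "Q' \<in> H"
        then have "(\<rho> ** reflection_matrix w) ** Q' \<in> H"
          using in_H mult by blast
        moreover have "Q = \<rho> ** ((\<rho> ** reflection_matrix w) ** Q')"
          by (simp add: Q matrix_mul_assoc \<rho>)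
        ultimately show ?thesis
          by blast
      next
        assume "\<exists>h\<in>H. Q' = \<rho> ** h"
        then obtain h where "h \<in> H" "Q' = \<rho> ** h"
          by blast
        then show ?thesis
          using in_H mult by (simp add: Q matrix_mul_assoc)
      qed
    qed
  qed
  from this[of UNIV Q] have "Q \<in> H \<or> (\<exists>h\<in>H. Q = \<rho> ** h)"
    using Q by (simp add: rotation_matrix_def)
  moreover have False if "h \<in> H" "Q = \<rho> ** h" for h
    using Q rotation[OF that(1)] \<rho>(2) that(2) by (simp add: rotation_matrix_def det_mul)
  ultimately show ?thesis
    by blast
qed

end

section \<open>Polar factors of a curve of matrices\<close>

text \<open>The derivative of squaring at \<open>K\<close> is the Lyapunov operator, invertible for
  positive definite \<open>K\<close>, so the inverse function theorem yields a square root near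
  \<open>K ** K\<close>.\<close>

lemma matrix_square_local_inverse:
  fixes K :: "real^'d^'d"
  assumes K: "pos_def K"
  obtains U V g where "open U" "K \<in> U" "open V" "K ** K \<in> V"
    "homeomorphism U V (\<lambda>N. N ** N) g"
proof -
  define f' where "f' N = Blinfun (\<lambda>H. N ** H + H ** N)" for N :: "real^'d^'d"
  have f': "blinfun_apply (f' N) = (\<lambda>H. N ** H + H ** N)" for N
    unfolding f'_def by (rule bounded_linear_Blinfun_apply[OF bounded_linear_lyapunov])
  have "linear f'"
    by (intro linearI blinfun_eqI) (simp_all add: f' plus_blinfun.rep_eq scaleR_blinfun.rep_eq matrix_algebra scaleR_add_right)
  then have contf': "continuous_on UNIV f'"
    using linear_continuous_on linear_conv_bounded_linear by blast
  obtain k where k: "linear k" "k \<circ> (\<lambda>H. K ** H + H ** K) = id"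
    using linear_injective_left_inverse[OF bounded_linear.linear[OF bounded_linear_lyapunov] lyapunov_inj[OF K]]
    by blast
  have "blinfun_apply (Blinfun k) = k"
    using k(1) by (intro bounded_linear_Blinfun_apply) (simp add: linear_conv_bounded_linear)
  then have inv: "Blinfun k o\<^sub>L f' K = id_blinfun"
    using k(2) by (intro blinfun_eqI) (simp add: f' fun_eq_iff)
  have der: "((\<lambda>N. N ** N) has_derivative blinfun_apply (f' N)) (at N)" for N
    unfolding f' by (intro matrix_mult.FDERIV has_derivative_ident)
  show ?thesis
    by (rule inverse_function_theorem[OF open_UNIV der contf' UNIV_I inv]) (rule that)
qed

text \<open>The symmetric part \<open>S\<close> is only assumed continuous: in the application it involves \<open>\<surd>\<bar>t\<bar>\<close>.\<close>

lemma polar_factor_curve: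
  fixes K E W :: "real^'d^'d" and S :: "real \<Rightarrow> real^'d^'d"
  assumes K: "pos_def K" and S: "continuous_on UNIV S" "\<And>t. transpose (S t) = S t" "S 0 = K"
    and E: "transpose E = - E" and W: "K ** W + W ** K = 2 *\<^sub>R E"
  defines "M \<equiv> \<lambda>t. S t + t *\<^sub>R E"
  obtains \<epsilon> c where "0 < \<epsilon>" "continuous_on (ball 0 \<epsilon>) c" "c 0 = mat 1"
    "(c has_vector_derivative W) (at 0)"
    "\<And>t. t \<in> ball 0 \<epsilon> \<Longrightarrow> orthogonal_matrix (c t)"
    "\<And>t. t \<in> ball 0 \<epsilon> \<Longrightarrow> transpose (transpose (c t) ** M t) = transpose (c t) ** M t"
proof -
  have Kt: "transpose K = K"
    using K by (simp add: pos_def_def)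
  have M0: "M 0 = K"
    by (simp add: M_def S)
  have contM: "continuous_on UNIV M"
    unfolding M_def by (intro continuous_intros S)
  obtain U V g where UV: "open U" "K \<in> U" "open V" "K ** K \<in> V"
    and hom: "homeomorphism U V (\<lambda>N. N ** N) g"
    using matrix_square_local_inverse[OF K] .
  \<comment> \<open>The symmetric polar factor: the branch of the square root of
    \<open>M\<^sup>T M\<close> that passes through \<open>K\<close>.\<close>
  define P where "P t = g (transpose (M t) ** M t)" for t
  define J where "J = {t. transpose (M t) ** M t \<in> V}"
  have contMM: "continuous_on UNIV (\<lambda>t. transpose (M t) ** M t)"
    by (intro matrix_mult.continuous_on bounded_linear.continuous_on[OF bounded_linear_transpose] contM)
  have "open J"
    using open_vimage[OF UV(3) contMM] by (simp add: J_def vimage_def)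
  have "0 \<in> J"
    using UV(4) by (simp add: J_def M0 Kt)
  have contg: "continuous_on V g" and gU: "g ` V = U"
    and gf: "\<And>N. N \<in> U \<Longrightarrow> g (N ** N) = N" and fg: "\<And>B. B \<in> V \<Longrightarrow> g B ** g B = B"
    using hom by (auto simp: homeomorphism_def)
  have contP: "continuous_on J P"
    unfolding P_def
    by (rule continuous_on_compose2[OF contg continuous_on_subset[OF contMM]]) (auto simp: J_def)
  have P0: "P 0 = K"
    using gf[OF UV(2)] by (simp add: P_def M0 Kt)
  have PP: "P t ** P t = transpose (M t) ** M t" if "t \<in> J" for t
    using that fg by (simp add: P_def J_def)
  \<comment> \<open>Where the transpose of \<open>P t\<close> also lies in \<open>U\<close>,
    injectivity of squaring on \<open>U\<close> makes \<open>P t\<close> symmetric; the determinant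
    condition makes it invertible.\<close>
  define J' where "J' = {t \<in> J. transpose (P t) \<in> U \<and> det (P t) \<noteq> 0}"
  have "open J'"
  proof -
    have "J' = (J \<inter> (\<lambda>t. transpose (P t)) -` U) \<inter> (J \<inter> (\<lambda>t. det (P t)) -` (- {0}))"
      by (auto simp: J'_def)
    moreover have "open (J \<inter> (\<lambda>t. transpose (P t)) -` U)"
      by (intro continuous_open_preimage[OF _ \<open>open J\<close> UV(1)]
          bounded_linear.continuous_on[OF bounded_linear_transpose contP])
    moreover have "open (J \<inter> (\<lambda>t. det (P t)) -` (- {0}))"
      unfolding det_def
      by (intro continuous_open_preimage[OF _ \<open>open J\<close>] continuous_intros contP)
    ultimately show ?thesis
      by (simp add: open_Int)
  qed
  moreover have "0 \<in> J'"
    using \<open>0 \<in> J\<close> UV(2) pos_def_invertible[OF K] by (simp add: J'_def P0 Kt invertible_det_nz)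
  ultimately obtain \<epsilon> where \<epsilon>: "0 < \<epsilon>" "ball 0 \<epsilon> \<subseteq> J'"
    by (meson open_contains_ball)
  have Jt: "t \<in> J" if "t \<in> ball 0 \<epsilon>" for t
    using \<epsilon>(2) that by (auto simp: J'_def)
  have Pt: "transpose (P t) = P t" if "t \<in> ball 0 \<epsilon>" for t
  proof -
    have "transpose (P t) ** transpose (P t) = transpose (M t) ** M t"
      using arg_cong[OF PP[OF Jt[OF that]], of transpose] by (simp add: matrix_transpose_mul)
    moreover have "transpose (P t) \<in> U"
      using that \<epsilon>(2) by (auto simp: J'_def)
    ultimately have "g (transpose (M t) ** M t) = transpose (P t)"
      using gf by metis
    then show ?thesis
      by (simp add: P_def)
  qed
  have Pinv: "invertible (P t)" if "t \<in> ball 0 \<epsilon>" for t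
    using that \<epsilon>(2) by (auto simp: J'_def invertible_det_nz)
  define c where "c t = M t ** matrix_inv (P t)" for t
  have cP: "c t ** P t = M t" if "t \<in> ball 0 \<epsilon>" for t
    using matrix_inv_left[OF Pinv[OF that]] by (simp add: c_def flip: matrix_mul_assoc)
  have orth: "transpose (c t) ** c t = mat 1" if t: "t \<in> ball 0 \<epsilon>" for t
  proof -
    let ?I = "matrix_inv (P t)"
    have I: "?I ** P t = mat 1" "P t ** ?I = mat 1"
      using matrix_inv_left matrix_inv_right Pinv[OF t] by auto
    have "P t ** (transpose (c t) ** c t) ** P t = transpose (c t ** P t) ** (c t ** P t)"
      by (simp add: matrix_transpose_mul Pt[OF t] matrix_mul_assoc)
    also have "\<dots> = P t ** P t"
      by (simp add: cP[OF t] PP[OF Jt[OF t]])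
    finally have "(?I ** P t) ** (transpose (c t) ** c t) ** (P t ** ?I) = (?I ** P t) ** (P t ** ?I)"
      by (metis matrix_mul_assoc)
    then show ?thesis
      by (simp add: I)
  qed
  have contc: "continuous_on (ball 0 \<epsilon>) c"
    unfolding c_def
    by (intro matrix_mult.continuous_on continuous_on_subset[OF contM] continuous_on_matrix_inv
        continuous_on_subset[OF contP]) (use Jt Pinv in auto)
  have c0: "c 0 = mat 1"
    using matrix_inv_right[OF pos_def_invertible[OF K]] by (simp add: c_def M0 P0)
  have sym: "transpose (c t) ** M t = P t" if "t \<in> ball 0 \<epsilon>" for t
    using orth[OF that] by (simp add: cP[OF that, symmetric] matrix_mul_assoc)
  \<comment> \<open>The merely continuous part \<open>S\<close> cancels here and leaves an
    expression linear in \<open>t\<close>; this is why the orthogonal factor is differentiable at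
    0.\<close>
  have Mskew: "M t - transpose (M t) = (2 * t) *\<^sub>R E" for t
    by (simp add: M_def S(2) transpose_linear_simps E flip: scaleR_add_left)
  define D where "D t = (1 / t) *\<^sub>R (c t - mat 1)" for t
  \<comment> \<open>The difference quotient solves a Lyapunov equation exactly, with coefficients
    that tend to \<open>K\<close>.\<close>
  have D: "D t ** P t + P t ** transpose (c t) ** D t = 2 *\<^sub>R E" if t: "t \<in> ball 0 \<epsilon>" "t \<noteq> 0" for t
  proof -
    have "(c t - mat 1) ** P t + P t ** transpose (c t) ** (c t - mat 1)
        = c t ** P t - P t ** transpose (c t) + (P t ** (transpose (c t) ** c t) - P t)"
      by (simp add: matrix_algebra)
    also have "\<dots> = M t - transpose (M t)"
      by (simp add: orth[OF t(1)] cP[OF t(1), symmetric] matrix_transpose_mul Pt[OF t(1)])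
    finally show ?thesis
      unfolding D_def matrix_mult.scaleR_left matrix_mult.scaleR_right Mskew
      using t(2) by (simp flip: scaleR_add_right)
  qed
  obtain C where C: "0 < C" "\<And>(A :: real^'d^'d) (B :: real^'d^'d). norm (A ** B) \<le> norm A * norm B * C"
    using matrix_mult.pos_bounded by blast
  obtain b where b: "0 < b" "\<And>X. b * norm X \<le> norm (K ** X + X ** K)"
    using linear_inj_bounded_below_pos[OF bounded_linear.linear[OF bounded_linear_lyapunov] lyapunov_inj[OF K]]
    by blast
  \<comment> \<open>Measures the error of the coefficients; \<open>b\<close> bounds the limiting
    operator from below.\<close>
  define \<eta> where "\<eta> t = norm (K - P t) + norm (K - P t ** transpose (c t))" for t
  have \<eta>: "(\<eta> \<longlongrightarrow> 0) (at 0)"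
  proof -
    have "continuous_on (ball 0 \<epsilon>) \<eta>"
      unfolding \<eta>_def
      by (intro continuous_intros matrix_mult.continuous_on contc continuous_on_subset[OF contP]
          bounded_linear.continuous_on[OF bounded_linear_transpose]) (use Jt in auto)
    then have "isCont \<eta> 0"
      using \<epsilon>(1) by (simp add: continuous_on_eq_continuous_at)
    then show ?thesis
      by (simp add: isCont_def \<eta>_def P0 c0)
  qed
  have "((\<lambda>t. D t - W) \<longlongrightarrow> 0) (at 0)"
  proof (rule Lim_null_comparison)
    show "((\<lambda>t. 2 / b * C * \<eta> t * norm W) \<longlongrightarrow> 0) (at 0)"
      using tendsto_mult[OF tendsto_mult[OF tendsto_const[of "2 / b * C"] \<eta>] tendsto_const[of "norm W"]]
      by (simp only: mult_zero_left mult_zero_right)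
    \<comment> \<open>Below this threshold for \<open>\<eta>\<close> the term
      \<open>C * \<eta> t * norm (D t - W)\<close> is at most half of
      \<open>b * norm (D t - W)\<close> and is absorbed on the left, so no prior bound on
      \<open>D\<close> is required.\<close>
    have "0 < b / (2 * C)"
      using b C by simp
    then have "\<forall>\<^sub>F t in at 0. \<eta> t < b / (2 * C)"
      using order_tendstoD(2)[OF \<eta>] by blast
    moreover have "\<forall>\<^sub>F t in at 0. t \<in> ball 0 \<epsilon> \<and> t \<noteq> 0"
      unfolding eventually_at using \<epsilon>(1) by (intro exI[of _ \<epsilon>]) (simp add: dist_commute)
    ultimately show "\<forall>\<^sub>F t in at 0. norm (D t - W) \<le> 2 / b * C * \<eta> t * norm W"
    proof eventually_elim
      case (elim t)
      have "K ** (D t - W) + (D t - W) ** K = K ** D t + D t ** K - (K ** W + W ** K)"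
        by (simp add: matrix_algebra)
      also have "\<dots> = (K - P t ** transpose (c t)) ** D t + D t ** (K - P t)"
        unfolding W using D[of t] elim by (simp add: matrix_algebra algebra_simps)
      finally have "b * norm (D t - W) \<le> norm ((K - P t ** transpose (c t)) ** D t + D t ** (K - P t))"
        using b(2)[of "D t - W"] by simp
      also have "\<dots> \<le> norm (K - P t ** transpose (c t)) * norm (D t) * C + norm (D t) * norm (K - P t) * C"
        using C(2)[of "K - P t ** transpose (c t)" "D t"] C(2)[of "D t" "K - P t"]
        by (intro norm_triangle_le) linarith
      also have "\<dots> = C * \<eta> t * norm (D t)"
        by (simp add: \<eta>_def algebra_simps)
      also have "\<dots> \<le> C * \<eta> t * (norm (D t - W) + norm W)"
        using C(1) norm_triangle_sub[of "D t" W] by (intro mult_left_mono) (auto simp: \<eta>_def add.commute)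
      also have "\<dots> = C * \<eta> t * norm (D t - W) + C * \<eta> t * norm W"
        by (simp add: algebra_simps)
      also have "C * \<eta> t * norm (D t - W) \<le> b / 2 * norm (D t - W)"
        using elim C(1) by (intro mult_right_mono) (auto simp: field_simps)
      finally show ?case
        using b(1) by (simp add: field_simps)
    qed
  qed
  then have "((\<lambda>t. norm (D t - W)) \<longlongrightarrow> 0) (at 0)"
    by (rule tendsto_norm_zero)
  moreover have "norm (D t - W) = norm (c t - c 0 - t *\<^sub>R W) / norm t" if "t \<noteq> 0" for t
  proof -
    have "D t - W = (1 / t) *\<^sub>R (c t - c 0 - t *\<^sub>R W)"
      using that by (simp add: D_def c0 scaleR_diff_right)
    then show ?thesis
      by simp
  qed
  then have "\<forall>\<^sub>F t in at 0. norm (D t - W) = norm (c t - c 0 - t *\<^sub>R W) / norm t"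
    unfolding eventually_at by (intro exI[of _ 1]) simp
  ultimately have "((\<lambda>t. norm (c t - c 0 - t *\<^sub>R W) / norm t) \<longlongrightarrow> 0) (at 0)"
    by (rule Lim_transform_eventually)
  then have "(c has_vector_derivative W) (at 0)"
    unfolding has_vector_derivative_def has_derivative_iff_norm by (simp add: bounded_linear_scaleR_left)
  moreover have "orthogonal_matrix (c t)" if "t \<in> ball 0 \<epsilon>" for t
    using orth[OF that] by (simp add: orthogonal_matrix)
  moreover have "transpose (transpose (c t) ** M t) = transpose (c t) ** M t" if "t \<in> ball 0 \<epsilon>" for t
    by (simp add: sym[OF that] Pt[OF that])
  ultimately show ?thesis
    using that[OF \<epsilon>(1) contc c0] by blast
qed

section \<open>Holonomy of lassos\<close>

lemma bundle_proj_quadratic: "bounded_bilinear (\<lambda>X Y :: real^'d^'n. X ** transpose Y)"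
  by (rule bounded_bilinear.comp[OF bounded_bilinear_matrix_mult bounded_linear_ident bounded_linear_transpose])

lemma continuous_on_bundle_proj: "continuous_on S (bundle_proj :: real^'d^'n \<Rightarrow> _)"
  unfolding bundle_proj_def
  by (intro matrix_mult.continuous_on bounded_linear.continuous_on[OF bounded_linear_transpose] continuous_on_id)

section \<open>From horizontal paths to holonomy elements\<close>

lemma horizontal_path_imp:
  assumes "horizontal_path g"
  shows "path g" "path_image g \<subseteq> total_space"
  using assms by (auto simp: horizontal_path_def piecewise_smooth_path_def)

lemma path_bundle_proj:
  fixes g :: "real \<Rightarrow> real^'d^'n"
  assumes "horizontal_path g"
  shows "path (bundle_proj \<circ> g)" "path_image (bundle_proj \<circ> g) \<subseteq> base_space TYPE('d)"
  using horizontal_path_imp[OF assms]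
  by (auto intro!: path_continuous_image continuous_on_bundle_proj simp: path_image_compose base_space_def)

text \<open>A horizontal path lifts its own projection, which is again piecewise smooth because the
  projection is quadratic. Loops can thus be handled through their lifts.\<close>

lemma restricted_holonomyI:
  fixes X :: "real^'d^'n"
  assumes "orthogonal_matrix Q" and g: "horizontal_path g" "pathstart g = X" "pathfinish g = X ** Q"
    and hom: "homotopic_paths (base_space TYPE('d)) (bundle_proj \<circ> g) (linepath (bundle_proj X) (bundle_proj X))"
  shows "Q \<in> restricted_holonomy (bundle_proj X) X"
proof -
  have "piecewise_smooth_path (\<lambda>t. g t ** transpose (g t))"
    using g(1) by (intro piecewise_smooth_path_quadratic[OF bundle_proj_quadratic]) (simp add: horizontal_path_def)
  then have "piecewise_smooth_path (bundle_proj \<circ> g)"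
    by (simp add: bundle_proj_def comp_def)
  then have "contractible_loop TYPE('d) (bundle_proj X) (bundle_proj \<circ> g)"
    using g hom assms(1) unfolding contractible_loop_def
    by (simp add: pathstart_compose pathfinish_compose bundle_proj_orthogonal)
  moreover have "has_holonomy X (bundle_proj \<circ> g) Q"
    using assms unfolding has_holonomy_def horizontal_lift_def by auto
  ultimately show ?thesis
    unfolding restricted_holonomy_def by blast
qed

lemma restricted_holonomyE:
  fixes X :: "real^'d^'n"
  assumes "Q \<in> restricted_holonomy p X"
  obtains g where "orthogonal_matrix Q" "horizontal_path g" "pathstart g = X" "pathfinish g = X ** Q"
    "p = bundle_proj X"
    "homotopic_paths (base_space TYPE('d)) (bundle_proj \<circ> g) (linepath p p)"
proof -
  obtain \<gamma> g where \<gamma>: "contractible_loop TYPE('d) p \<gamma>" and Q: "orthogonal_matrix Q"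
    and g: "horizontal_lift \<gamma> g" "pathstart g = X" "pathfinish g = X ** Q"
    using assms unfolding restricted_holonomy_def has_holonomy_def by blast
  have hg: "horizontal_path g" and proj: "\<And>t. t \<in> {0..1} \<Longrightarrow> bundle_proj (g t) = \<gamma> t"
    using g(1) unfolding horizontal_lift_def by auto
  have "p = bundle_proj X"
    using \<gamma> proj[of 0] g(2) by (simp add: contractible_loop_def pathstart_def)
  moreover have "homotopic_paths (base_space TYPE('d)) (bundle_proj \<circ> g) \<gamma>"
    using path_bundle_proj[OF hg] proj by (intro homotopic_paths_eq) auto
  then have "homotopic_paths (base_space TYPE('d)) (bundle_proj \<circ> g) (linepath p p)"
    using \<gamma> unfolding contractible_loop_def by (blast intro: homotopic_paths_trans)
  ultimately show ?thesis
    using that Q hg g by blast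
qed

lemma bundle_proj_comp_orthogonal:
  "orthogonal_matrix Q \<Longrightarrow> bundle_proj \<circ> (\<lambda>t. g t ** Q) = bundle_proj \<circ> g"
  by (simp add: fun_eq_iff bundle_proj_orthogonal)

text \<open>The path for \<open>B\<close> comes first and ends at \<open>X ** B\<close>; the path
  for \<open>A\<close>, translated by \<open>B\<close>, continues from there to
  \<open>X ** A ** B\<close>.\<close>

lemma restricted_holonomy_mult:
  fixes X :: "real^'d^'n"
  assumes "A \<in> restricted_holonomy p X" "B \<in> restricted_holonomy p X"
  shows "A ** B \<in> restricted_holonomy p X"
proof -
  let ?S = "base_space TYPE('d) :: (real^'n^'n) set"
  from assms(1) obtain g where A: "orthogonal_matrix A" and g: "horizontal_path g" "pathstart g = X"
    "pathfinish g = X ** A" and p: "p = bundle_proj X"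
    and hg: "homotopic_paths ?S (bundle_proj \<circ> g) (linepath p p)"
    by (rule restricted_holonomyE)
  from assms(2) obtain h where B: "orthogonal_matrix B" and h: "horizontal_path h" "pathstart h = X"
    "pathfinish h = X ** B" and hh: "homotopic_paths ?S (bundle_proj \<circ> h) (linepath p p)"
    by (rule restricted_holonomyE)
  define k where "k = h +++ (\<lambda>t. g t ** B)"
  have fs: "pathfinish h = pathstart (\<lambda>t. g t ** B)"
    using g h by (simp add: pathstart_def)
  have "horizontal_path k"
    unfolding k_def by (intro horizontal_path_join h horizontal_path_orthogonal g B fs)
  moreover have "pathstart k = X" "pathfinish k = X ** (A ** B)"
    unfolding k_def pathstart_join pathfinish_join
    using g h by (simp_all add: pathfinish_def matrix_mul_assoc)
  moreover have "homotopic_paths ?S (bundle_proj \<circ> k) (linepath (bundle_proj X) (bundle_proj X))"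
  proof -
    have "bundle_proj \<circ> k = (bundle_proj \<circ> h) +++ (bundle_proj \<circ> g)"
      unfolding k_def path_compose_join bundle_proj_comp_orthogonal[OF B] ..
    moreover have "homotopic_paths ?S ((bundle_proj \<circ> h) +++ (bundle_proj \<circ> g)) (linepath p p +++ linepath p p)"
      using g h p B by (intro homotopic_paths_join hg hh)
        (simp add: pathstart_compose pathfinish_compose bundle_proj_orthogonal)
    moreover have "p \<in> ?S"
      using homotopic_paths_imp_subset[OF hg] by simp
    then have "homotopic_paths ?S (linepath p p +++ linepath p p) (linepath p p)"
      by (intro homotopic_paths_lid') auto
    ultimately show ?thesis
      unfolding p by (auto intro: homotopic_paths_trans)
  qed
  ultimately show ?thesis
    unfolding p by (intro restricted_holonomyI orthogonal_matrix_mul A B)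
qed

text \<open>Go along \<open>g\<close>, around the loop at \<open>q\<close>, and back along
  \<open>g\<close> translated by \<open>Q\<close>. The lift ends at \<open>X ** Q\<close>, and the
  projection is a conjugate of a contractible loop.\<close>

lemma restricted_holonomy_lasso:
  fixes X q :: "real^'d^'n"
  assumes g: "horizontal_path g" "pathstart g = X" "pathfinish g = q"
    and Q: "Q \<in> restricted_holonomy (bundle_proj q) q"
  shows "Q \<in> restricted_holonomy (bundle_proj X) X"
proof -
  let ?S = "base_space TYPE('d) :: (real^'n^'n) set"
  let ?q = "bundle_proj q" and ?X = "bundle_proj X"
  from Q obtain h where Q: "orthogonal_matrix Q" and h: "horizontal_path h" "pathstart h = q"
    "pathfinish h = q ** Q" and hh: "homotopic_paths ?S (bundle_proj \<circ> h) (linepath ?q ?q)"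
    by (rule restricted_holonomyE)
  define r where "r = (\<lambda>t. reversepath g t ** Q)"
  have r: "horizontal_path r" "pathstart r = q ** Q" "pathfinish r = X ** Q"
    using g horizontal_path_orthogonal[OF horizontal_path_reversepath[OF g(1)] Q]
    by (simp_all add: r_def pathstart_def pathfinish_def reversepath_def)
  have proj_r: "bundle_proj \<circ> r = reversepath (bundle_proj \<circ> g)"
    unfolding r_def bundle_proj_comp_orthogonal[OF Q] by (simp add: reversepath_def fun_eq_iff)
  note pg = path_bundle_proj[OF g(1)] and ph = path_bundle_proj[OF h(1)]
  have ends: "pathstart (bundle_proj \<circ> g) = ?X" "pathfinish (bundle_proj \<circ> g) = ?q"
    using g by (simp_all add: pathstart_compose pathfinish_compose)
  have "horizontal_path (g +++ (h +++ r))"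
    by (intro horizontal_path_join g h r) (simp_all add: g h r)
  moreover have "pathstart (g +++ (h +++ r)) = X" "pathfinish (g +++ (h +++ r)) = X ** Q"
    using g h r by simp_all
  moreover have "homotopic_paths ?S (bundle_proj \<circ> (g +++ (h +++ r))) (linepath ?X ?X)"
  proof -
    have "homotopic_paths ?S ((bundle_proj \<circ> h) +++ reversepath (bundle_proj \<circ> g))
        (linepath ?q ?q +++ reversepath (bundle_proj \<circ> g))"
      using pg h ends Q by (intro homotopic_paths_join hh) (simp_all add: pathfinish_compose bundle_proj_orthogonal)
    also have "homotopic_paths ?S (linepath ?q ?q +++ reversepath (bundle_proj \<circ> g)) (reversepath (bundle_proj \<circ> g))"
      using pg ends by (intro homotopic_paths_lid') simp_all
    finally have "homotopic_paths ?S ((bundle_proj \<circ> g) +++ ((bundle_proj \<circ> h) +++ reversepath (bundle_proj \<circ> g)))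
        ((bundle_proj \<circ> g) +++ reversepath (bundle_proj \<circ> g))"
      using pg ends h by (intro homotopic_paths_join) (simp_all add: pathstart_compose)
    also have "homotopic_paths ?S ((bundle_proj \<circ> g) +++ reversepath (bundle_proj \<circ> g)) (linepath ?X ?X)"
      using homotopic_paths_rinv[OF pg] by (simp only: ends)
    finally show ?thesis
      by (simp only: path_compose_join proj_r)
  qed
  ultimately show ?thesis
    by (rule restricted_holonomyI[OF Q])
qed

text \<open>A horizontal path in a convex part of the total space which joins \<open>q\<close> to a point of its own
  fibre can be deformed into that fibre.\<close>

lemma restricted_holonomy_convex:
  fixes q :: "real^'d^'n"
  assumes S: "convex S" "S \<subseteq> total_space"
    and \<sigma>: "horizontal_path \<sigma>" "path_image \<sigma> \<subseteq> S" "pathstart \<sigma> = q"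
    and \<rho>: "path \<rho>" "\<And>x. x \<in> {0..1} \<Longrightarrow> orthogonal_matrix (\<rho> x) \<and> q ** \<rho> x \<in> S" "pathstart \<rho> = mat 1"
    and fin: "pathfinish \<sigma> = q ** pathfinish \<rho>"
  shows "pathfinish \<rho> \<in> restricted_holonomy (bundle_proj q) q"
proof (rule restricted_holonomyI[OF _ \<sigma>(1,3) fin])
  show "orthogonal_matrix (pathfinish \<rho>)"
    using \<rho>(2) by (simp add: pathfinish_def)
  have pr: "path (\<lambda>x. q ** \<rho> x)"
    using \<rho>(1) unfolding path_def by (intro matrix_mult.continuous_on continuous_on_const)
  have "homotopic_paths S \<sigma> (\<lambda>x. q ** \<rho> x)"
  proof (rule homotopic_paths_linear)
    show "pathstart (\<lambda>x. q ** \<rho> x) = pathstart \<sigma>" "pathfinish (\<lambda>x. q ** \<rho> x) = pathfinish \<sigma>"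
      using \<rho>(3) \<sigma>(3) fin by (simp_all add: pathstart_def pathfinish_def)
    show "closed_segment (\<sigma> t) (q ** \<rho> t) \<subseteq> S" if "t \<in> {0..1}" for t
      using that \<sigma>(2) \<rho>(2) by (intro closed_segment_subset S) (auto simp: path_image_def)
  qed (use horizontal_path_imp[OF \<sigma>(1)] pr in auto)
  then have "homotopic_paths (base_space TYPE('d)) (bundle_proj \<circ> \<sigma>) (bundle_proj \<circ> (\<lambda>x. q ** \<rho> x))"
    using S(2) by (elim homotopic_paths_continuous_image) (auto simp: continuous_on_bundle_proj base_space_def)
  moreover have "homotopic_paths (base_space TYPE('d)) (bundle_proj \<circ> (\<lambda>x. q ** \<rho> x)) (linepath (bundle_proj q) (bundle_proj q))"
  proof (rule homotopic_paths_eq)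
    show "path (bundle_proj \<circ> (\<lambda>x. q ** \<rho> x))"
      by (intro path_continuous_image pr continuous_on_bundle_proj)
    show "path_image (bundle_proj \<circ> (\<lambda>x. q ** \<rho> x)) \<subseteq> base_space TYPE('d)"
      using \<rho>(2) S(2) by (auto simp: path_image_def base_space_def intro!: imageI)
    show "(bundle_proj \<circ> (\<lambda>x. q ** \<rho> x)) t = linepath (bundle_proj q) (bundle_proj q) t" if "t \<in> {0..1}" for t
      using \<rho>(2)[OF that] by (simp add: bundle_proj_orthogonal linepath_refl)
  qed
  ultimately show "homotopic_paths (base_space TYPE('d)) (bundle_proj \<circ> \<sigma>) (linepath (bundle_proj q) (bundle_proj q))"
    by (rule homotopic_paths_trans)
qed

text \<open>With the vertices of the broken line, \<open>q\<^sup>T y\<^sub>2\<close> has symmetric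
  terms of first order in \<open>s1\<close> and \<open>s2\<close>, and only its
  \<open>s1 * s2\<close> term has a skew part. Hence its orthogonal polar factor has velocity
  \<open>W\<close> at 0.\<close>

lemma triangle_holonomy_curve:
  fixes q :: "real^'d^'n" and W :: "real^'d^'d"
  assumes q: "q \<in> total_space" and U: "transpose U = U" and Y: "transpose Y = Y"
    and W: "(transpose q ** q) ** W + W ** (transpose q ** q) = transpose q ** (Y ** U - U ** Y) ** q"
  obtains \<epsilon> c where "0 < \<epsilon>" "continuous_on (ball 0 \<epsilon>) c" "c 0 = mat 1"
    "(c has_vector_derivative W) (at 0)"
    "\<And>t. t \<in> ball 0 \<epsilon> \<Longrightarrow> c t \<in> restricted_holonomy (bundle_proj q) q"
proof -
  define K where "K = transpose q ** q"
  \<comment> \<open>The sign is put into one factor, so that the product of the two continuous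
    functions is \<open>t\<close> for either sign of \<open>t\<close>.\<close>
  define s1 :: "real \<Rightarrow> real" where "s1 t = sgn t * sqrt \<bar>t\<bar>" for t
  define s2 :: "real \<Rightarrow> real" where "s2 t = sqrt \<bar>t\<bar>" for t
  have s12: "s1 t * s2 t = t" for t
    by (simp add: s1_def s2_def mult.assoc sgn_mult_abs)
  have cont_s: "continuous_on UNIV s1" "continuous_on UNIV s2"
  proof -
    have "s1 t = sqrt (max t 0) - sqrt (max (- t) 0)" for t
      by (simp add: s1_def sgn_if max_def)
    then have "s1 = (\<lambda>t. sqrt (max t 0) - sqrt (max (- t) 0))"
      by blast
    then show "continuous_on UNIV s1"
      by (simp only:) (intro continuous_intros)
    show "continuous_on UNIV s2"
      unfolding s2_def by (intro continuous_intros)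
  qed
  define y1 where "y1 t = q + s1 t *\<^sub>R (U ** q)" for t
  define y2 where "y2 t = y1 t + s2 t *\<^sub>R (Y ** y1 t)" for t
  have cont_y: "continuous_on UNIV y1" "continuous_on UNIV y2"
    unfolding y2_def y1_def by (intro continuous_intros matrix_mult.continuous_on cont_s)+
  have y0: "y1 0 = q" "y2 0 = q"
    by (simp_all add: y1_def y2_def s1_def s2_def)
  define E where "E = skew_part (transpose q ** (Y ** U) ** q)"
  define S where "S t = K + s1 t *\<^sub>R (transpose q ** U ** q) + s2 t *\<^sub>R (transpose q ** Y ** q)
      + t *\<^sub>R sym_part (transpose q ** (Y ** U) ** q)" for t
  have M: "transpose q ** y2 t = S t + t *\<^sub>R E" for t
  proof -
    have "transpose q ** y2 t = K + s1 t *\<^sub>R (transpose q ** U ** q) + s2 t *\<^sub>R (transpose q ** Y ** q)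
        + (s1 t * s2 t) *\<^sub>R (transpose q ** (Y ** U) ** q)"
      by (simp add: y2_def y1_def K_def matrix_algebra scaleR_add_right)
    also have "transpose q ** (Y ** U) ** q = sym_part (transpose q ** (Y ** U) ** q) + E"
      unfolding E_def using skew_part_plus_sym_part by (metis add.commute)
    finally show ?thesis
      by (simp add: s12 S_def scaleR_add_right)
  qed
  have Kt: "transpose K = K"
    by (simp add: K_def matrix_transpose_mul)
  have "continuous_on UNIV S"
    unfolding S_def by (intro continuous_intros cont_s)
  moreover have "transpose (S t) = S t" for t
    by (simp add: S_def transpose_linear_simps transpose_sym_part Kt matrix_transpose_mul U Y matrix_mul_assoc)
  moreover have "S 0 = K"
    by (simp add: S_def s1_def s2_def)
  moreover have "transpose E = - E"
    using skew_part_in_skew_matrices by (simp add: E_def skew_matrices_def)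
  moreover have "K ** W + W ** K = 2 *\<^sub>R E"
    using W by (simp add: K_def E_def skew_part_def matrix_algebra U Y)
  ultimately obtain \<epsilon> c where c: "0 < \<epsilon>" "continuous_on (ball 0 \<epsilon>) c" "c 0 = mat 1"
    "(c has_vector_derivative W) (at 0)"
    "\<And>t. t \<in> ball 0 \<epsilon> \<Longrightarrow> orthogonal_matrix (c t)"
    "\<And>t. t \<in> ball 0 \<epsilon> \<Longrightarrow> transpose (transpose (c t) ** (S t + t *\<^sub>R E)) = transpose (c t) ** (S t + t *\<^sub>R E)"
    using polar_factor_curve[of K S E W] pos_def_gram[OF q] unfolding K_def by blast
  obtain r where r: "0 < r" "ball q r \<subseteq> total_space"
    using open_total_space q by (meson open_contains_ball)
  \<comment> \<open>Parameters for which all vertices lie in one ball inside the total space, whose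
    convexity contains the segments.\<close>
  define T where "T = {t \<in> ball 0 \<epsilon>. y1 t \<in> ball q r \<and> y2 t \<in> ball q r \<and> q ** c t \<in> ball q r}"
  have "open T"
  proof -
    have "T = (ball 0 \<epsilon> \<inter> (\<lambda>t. q ** c t) -` ball q r) \<inter> (y1 -` ball q r \<inter> y2 -` ball q r)"
      by (auto simp: T_def)
    moreover have "open (ball 0 \<epsilon> \<inter> (\<lambda>t. q ** c t) -` ball q r)"
      by (intro continuous_open_preimage matrix_mult.continuous_on c(2) continuous_on_const) auto
    moreover have "open (y1 -` ball q r)" "open (y2 -` ball q r)"
      by (intro open_vimage cont_y open_ball)+
    ultimately show ?thesis
      by (simp add: open_Int)
  qed
  moreover have "0 \<in> T"
    using c(1,3) r(1) by (simp add: T_def y0)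
  ultimately obtain \<delta> where \<delta>: "0 < \<delta>" "ball 0 \<delta> \<subseteq> T"
    by (meson open_contains_ball)
  have "c t \<in> restricted_holonomy (bundle_proj q) q" if t: "t \<in> ball 0 \<delta>" for t
  proof -
    define \<sigma> where "\<sigma> = linepath q (y1 t) +++ (linepath (y1 t) (y2 t) +++ linepath (y2 t) (q ** c t))"
    \<comment> \<open>Running the curve itself from 0 to \<open>t\<close> joins the identity to
      \<open>c t\<close> inside the orthogonal group, as the contraction into the fibre
      demands.\<close>
    define \<rho> where "\<rho> x = c (x * t)" for x
    have xt: "x * t \<in> ball 0 \<delta>" if "x \<in> {0..1}" for x
    proof -
      have "\<bar>x\<bar> * \<bar>t\<bar> \<le> 1 * \<bar>t\<bar>"
        using that by (intro mult_right_mono) auto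
      then show ?thesis
        using t by (simp add: abs_mult)
    qed
    have tT: "x * t \<in> T" if "x \<in> {0..1}" for x
      using xt[OF that] \<delta>(2) by blast
    have inb: "q \<in> ball q r" "y1 t \<in> ball q r" "y2 t \<in> ball q r" "q ** c t \<in> ball q r" and te: "t \<in> ball 0 \<epsilon>"
      using tT[of 1] r(1) by (simp_all add: T_def)
    have seg: "closed_segment a b \<subseteq> ball q r" if "a \<in> ball q r" "b \<in> ball q r" for a b
      using that by (intro closed_segment_subset convex_ball)
    have seg': "closed_segment a b \<subseteq> total_space" if "a \<in> ball q r" "b \<in> ball q r" for a b
      using seg[OF that] r(2) by blast
    have 1: "horizontal_path (linepath q (y1 t))"
      by (intro horizontal_path_linepath seg' inb)
        (simp add: y1_def matrix_algebra U)
    have 2: "horizontal_path (linepath (y1 t) (y2 t))"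
      by (intro horizontal_path_linepath seg' inb)
        (simp add: y2_def matrix_algebra Y)
    \<comment> \<open>The defining property of the polar factor is exactly the horizontality of the
      closing segment.\<close>
    have "transpose (c t) ** (transpose q ** y2 t) = transpose (transpose (c t) ** (transpose q ** y2 t))"
      using c(6)[OF te] by (simp only: M)
    then have 3: "horizontal_path (linepath (y2 t) (q ** c t))"
      by (intro horizontal_path_linepath seg' inb)
        (simp add: matrix_transpose_mul matrix_mul_assoc)
    have "pathfinish \<rho> \<in> restricted_holonomy (bundle_proj q) q"
    proof (rule restricted_holonomy_convex[OF convex_ball r(2)])
      show "horizontal_path \<sigma>"
        unfolding \<sigma>_def by (intro horizontal_path_join 1 2 3) simp_all
      show "path_image \<sigma> \<subseteq> ball q r"
        unfolding \<sigma>_def by (intro order_trans[OF path_image_join_subset] Un_least)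
          (simp only: path_image_linepath, intro seg inb)+
      show "path \<rho>"
        unfolding \<rho>_def path_def
        by (rule continuous_on_compose2[OF c(2)]) (use tT in \<open>auto simp: T_def intro!: continuous_intros\<close>)
      show "orthogonal_matrix (\<rho> x) \<and> q ** \<rho> x \<in> ball q r" if "x \<in> {0..1}" for x
        using tT[OF that] c(5) by (simp add: T_def \<rho>_def)
    qed (simp_all add: \<sigma>_def \<rho>_def pathstart_def pathfinish_def joinpaths_def linepath_0' linepath_1' c(3))
    then show ?thesis
      by (simp add: \<rho>_def pathfinish_def)
  qed
  moreover have "continuous_on (ball 0 \<delta>) c"
    using \<delta>(2) by (intro continuous_on_subset[OF c(2)]) (auto simp: T_def)
  ultimately show ?thesis
    using that[OF \<delta>(1) _ c(3,4)] by blast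
qed

lemma curvature_holonomy_curve:
  fixes Xp :: "real^'d^'n"
  assumes A: "A \<in> transported_curvature_values Xp"
  obtains \<epsilon> c where "0 < \<epsilon>" "continuous_on (ball 0 \<epsilon>) c" "c 0 = mat 1"
    "(c has_vector_derivative A) (at 0)"
    "\<And>t. t \<in> ball 0 \<epsilon> \<Longrightarrow> c t \<in> restricted_holonomy (bundle_proj Xp) Xp"
proof -
  obtain q u v where A: "A = curvature q u v" and reach: "horizontally_reachable Xp q"
    and u: "u \<in> horizontal_space q" and v: "v \<in> horizontal_space q"
    using A unfolding transported_curvature_values_def by blast
  obtain g where g: "horizontal_path g" "pathstart g = Xp" "pathfinish g = q"
    using reach unfolding horizontally_reachable_def by blast
  have q: "q \<in> total_space"
    using horizontal_path_imp(2)[OF g(1)] pathfinish_in_path_image[of g] g(3) by auto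
  obtain U where U: "transpose U = U" "U ** q = u"
    using horizontal_vector_as_symmetric_mult[OF q u] .
  obtain Y where Y: "transpose Y = Y" "Y ** q = v"
    using horizontal_vector_as_symmetric_mult[OF q v] .
  \<comment> \<open>The factor -2 normalises the velocity of the holonomy curve to the curvature
    value itself, sign included.\<close>
  have U2: "transpose (- 2 *\<^sub>R U) = - 2 *\<^sub>R U"
    by (simp add: transpose_linear_simps U)
  have "(transpose q ** q) ** A + A ** (transpose q ** q) = 2 *\<^sub>R (transpose u ** v - transpose v ** u)"
    unfolding A by (rule curvature_equation[OF q u v])
  also have "\<dots> = transpose q ** (Y ** (- 2 *\<^sub>R U) - (- 2 *\<^sub>R U) ** Y) ** q"
    unfolding U(2)[symmetric] Y(2)[symmetric]
    by (simp add: matrix_algebra U(1) Y(1) scaleR_diff_right)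
  finally have W: "(transpose q ** q) ** A + A ** (transpose q ** q) =
      transpose q ** (Y ** (- 2 *\<^sub>R U) - (- 2 *\<^sub>R U) ** Y) ** q" .
  obtain \<epsilon> c where c: "0 < \<epsilon>" "continuous_on (ball 0 \<epsilon>) c" "c 0 = mat 1"
    "(c has_vector_derivative A) (at 0)"
    "\<And>t. t \<in> ball 0 \<epsilon> \<Longrightarrow> c t \<in> restricted_holonomy (bundle_proj q) q"
    using triangle_holonomy_curve[OF q U2 Y(1) W] by blast
  show ?thesis
    by (rule that[OF c(1-4)]) (rule restricted_holonomy_lasso[OF g c(5)])
qed

section \<open>A neighbourhood of the identity\<close>

text \<open>Multiplying the curves, each evaluated at its own linear coordinate of the parameter,
  adds their velocities at 0, since all factors equal the identity there.\<close>

lemma product_of_curves: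
  fixes H :: "(real^'d^'d) set" and \<tau> :: "real^'d^'d \<Rightarrow> 'm::real_normed_vector \<Rightarrow> real"
  assumes mult: "\<And>A B. A \<in> H \<Longrightarrow> B \<in> H \<Longrightarrow> A ** B \<in> H" and one: "mat 1 \<in> H"
    and "finite B" and \<tau>: "\<And>b. bounded_linear (\<tau> b)"
    and curve: "\<And>b. b \<in> B \<Longrightarrow> \<exists>\<epsilon> c. 0 < \<epsilon> \<and> continuous_on (ball 0 \<epsilon>) c \<and> c 0 = mat 1 \<and>
      (c has_vector_derivative b) (at 0) \<and> (\<forall>t\<in>ball 0 \<epsilon>. c t \<in> H)"
  shows "\<exists>N F. open N \<and> 0 \<in> N \<and> continuous_on N F \<and> F 0 = mat 1 \<and> F ` N \<subseteq> H \<and>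
    (F has_derivative (\<lambda>M. \<Sum>b\<in>B. \<tau> b M *\<^sub>R b)) (at 0)"
  using assms(3) curve
proof (induction B rule: finite_induct)
  case empty
  show ?case
    using one by (intro exI[of _ UNIV] exI[of _ "\<lambda>_. mat 1"]) auto
next
  case (insert b B)
  then obtain N F where N: "open N" "0 \<in> N" and F: "continuous_on N F" "F 0 = mat 1" "F ` N \<subseteq> H"
    and dF: "(F has_derivative (\<lambda>M. \<Sum>b\<in>B. \<tau> b M *\<^sub>R b)) (at 0)"
    by blast
  obtain \<epsilon> c where c: "0 < \<epsilon>" "continuous_on (ball 0 \<epsilon>) c" "c 0 = mat 1"
      "(c has_vector_derivative b) (at 0)" "\<And>t. t \<in> ball 0 \<epsilon> \<Longrightarrow> c t \<in> H"
    using insert.prems[of b] by blast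
  have \<tau>0: "\<tau> b 0 = 0"
    using linear_0[OF bounded_linear.linear[OF \<tau>]] .
  define N' where "N' = N \<inter> \<tau> b -` ball 0 \<epsilon>"
  have "open N'" "0 \<in> N'"
    unfolding N'_def using N c(1) \<tau>0 linear_continuous_on[OF \<tau>]
    by (auto intro!: open_Int open_vimage)
  moreover have "continuous_on N' (\<lambda>M. c (\<tau> b M) ** F M)"
    by (intro matrix_mult.continuous_on continuous_on_compose2[OF c(2) linear_continuous_on[OF \<tau>]]
        continuous_on_subset[OF F(1)]) (auto simp: N'_def)
  moreover have "(\<lambda>M. c (\<tau> b M) ** F M) ` N' \<subseteq> H"
    using c(5) F(3) mult by (auto simp: N'_def)
  moreover have "((\<lambda>M. c (\<tau> b M) ** F M) has_derivative (\<lambda>M. \<Sum>b\<in>insert b B. \<tau> b M *\<^sub>R b)) (at 0)"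
  proof -
    have "((\<lambda>M. c (\<tau> b M)) has_derivative (\<lambda>M. \<tau> b M *\<^sub>R b)) (at 0)"
      using has_derivative_compose[OF bounded_linear_imp_has_derivative[OF \<tau>], of c "\<lambda>t. t *\<^sub>R b" b 0] c(4)
      by (simp add: has_vector_derivative_def \<tau>0)
    from matrix_mult.FDERIV[OF this dF] show ?thesis
      using insert.hyps by (simp add: c(3) F(2) \<tau>0 add.commute)
  qed
  ultimately show ?case
    using F(2) c(3) \<tau>0 by (intro exI[of _ N'] exI[of _ "\<lambda>M. c (\<tau> b M) ** F M"]) simp
qed

text \<open>Multiplying the product of the curves by \<open>I + S\<close> with \<open>S\<close> symmetric gives a map between full
  matrix spaces with derivative the identity, so that the open mapping theorem needs no charts. Near
  the identity the factor \<open>I + S\<close> of an orthogonal matrix is trivial.\<close>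

lemma identity_neighbourhood:
  fixes H :: "(real^'d^'d) set"
  assumes mult: "\<And>A B. A \<in> H \<Longrightarrow> B \<in> H \<Longrightarrow> A ** B \<in> H" and one: "mat 1 \<in> H"
    and orth: "\<And>A. A \<in> H \<Longrightarrow> orthogonal_matrix A"
    and T: "span T = skew_matrices"
    and curve: "\<And>b. b \<in> T \<Longrightarrow> \<exists>\<epsilon> c. 0 < \<epsilon> \<and> continuous_on (ball 0 \<epsilon>) c \<and> c 0 = mat 1 \<and>
      (c has_vector_derivative b) (at 0) \<and> (\<forall>t\<in>ball 0 \<epsilon>. c t \<in> H)"
  obtains e where "0 < e" "\<And>Q. orthogonal_matrix Q \<Longrightarrow> dist Q (mat 1) < e \<Longrightarrow> Q \<in> H"
proof -
  obtain B where B: "B \<subseteq> T" "independent B" "T \<subseteq> span B"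
    using maximal_independent_subset[of T] by blast
  have spB: "span B = skew_matrices"
    using B(1,3) T by (metis span_mono span_span subset_antisym)
  have finB: "finite B"
    using B(2) finiteI_independent by blast
  \<comment> \<open>Coordinates of the skew part in the basis \<open>B\<close>, so that the product
    of curves has derivative \<open>skew_part\<close> at 0.\<close>
  define \<tau> where "\<tau> b M = representation B (skew_part M) b" for b M
  have skew: "skew_part M \<in> span B" for M :: "real^'d^'d"
    by (simp add: spB skew_part_in_skew_matrices)
  have lin: "linear (skew_part :: real^'d^'d \<Rightarrow> real^'d^'d)"
    by (rule bounded_linear.linear[OF bounded_linear_skew_part])
  have "linear (\<tau> b)" for b
    by (intro linearI) (simp_all add: \<tau>_def linear_add[OF lin] linear_cmul[OF lin] representation_add[OF B(2) skew skew] representation_scale[OF B(2) skew])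
  then have \<tau>: "bounded_linear (\<tau> b)" for b
    by (simp add: linear_conv_bounded_linear)
  have sum\<tau>: "(\<Sum>b\<in>B. \<tau> b M *\<^sub>R b) = skew_part M" for M
    unfolding \<tau>_def by (rule sum_representation_eq[OF B(2) skew finB subset_refl])
  have "\<exists>N F. open N \<and> 0 \<in> N \<and> continuous_on N F \<and> F 0 = mat 1 \<and> F ` N \<subseteq> H \<and>
      (F has_derivative (\<lambda>M. \<Sum>b\<in>B. \<tau> b M *\<^sub>R b)) (at 0)"
    by (rule product_of_curves[OF mult one finB \<tau>]) (use B(1) curve in auto)
  then obtain N F where N: "open N" "0 \<in> N" and F: "continuous_on N F" "F 0 = mat 1" "F ` N \<subseteq> H"
    and dF: "(F has_derivative skew_part) (at 0)"
    unfolding sum\<tau> by (auto simp: eta_contract_eq)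
  obtain C where C: "0 < C" "\<And>(A :: real^'d^'d) (B :: real^'d^'d). norm (A ** B) \<le> norm A * norm B * C"
    using matrix_mult.pos_bounded by blast
  define f where "f M = F M ** (mat 1 + sym_part M)" for M
  \<comment> \<open>The radius \<open>2 / C\<close> excludes nonzero solutions of
    \<open>s ** s = - 2 *\<^sub>R s\<close>, because \<open>C\<close> bounds the norm of a
    product.\<close>
  define N' where "N' = N \<inter> sym_part -` ball 0 (2 / C)"
  have sym0: "sym_part (0 :: real^'d^'d) = 0"
    using linear_0[OF bounded_linear.linear[OF bounded_linear_sym_part]] .
  have N': "open N'" "0 \<in> N'"
    unfolding N'_def using N C(1) linear_continuous_on[OF bounded_linear_sym_part]
    by (auto intro!: open_Int open_vimage simp: sym0)
  have "continuous_on N' f"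
    unfolding f_def
    by (intro matrix_mult.continuous_on continuous_on_subset[OF F(1)] continuous_intros
        linear_continuous_on[OF bounded_linear_sym_part]) (auto simp: N'_def)
  moreover have "(f has_derivative (\<lambda>M. M)) (at 0)"
  proof -
    have "((\<lambda>M. mat 1 + sym_part M) has_derivative sym_part) (at 0)"
      using has_derivative_add[OF has_derivative_const bounded_linear_imp_has_derivative[OF bounded_linear_sym_part]]
      by simp
    from matrix_mult.FDERIV[OF dF this] show ?thesis
      by (simp add: f_def[abs_def] F(2) sym0 add.commute skew_part_plus_sym_part)
  qed
  \<comment> \<open>The open mapping theorem applies to a continuous map differentiable at the
    single point 0 with invertible derivative, which is all the holonomy curves provide.\<close>
  ultimately have "f 0 \<in> interior (f ` N')"
    using N' by (intro sussmann_open_mapping[where S = N' and f' = "\<lambda>M. M" and g' = "\<lambda>M. M"])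
      (auto simp: interior_open bounded_linear_ident comp_def id_def)
  then obtain e where e: "0 < e" "ball (mat 1) e \<subseteq> f ` N'"
    by (auto simp: mem_interior f_def F(2) sym0)
  have "Q \<in> H" if Q: "orthogonal_matrix Q" "dist Q (mat 1) < e" for Q
  proof -
    obtain M where M: "M \<in> N'" "Q = F M ** (mat 1 + sym_part M)"
      using e(2) Q(2) by (auto simp: f_def dist_commute)
    define s where "s = sym_part M"
    have FM: "F M \<in> H" "transpose (F M) ** F M = mat 1"
      using M(1) F(3) orth by (auto simp: N'_def orthogonal_matrix)
    \<comment> \<open>Both \<open>Q\<close> and \<open>F M\<close> are orthogonal, so the symmetric
      factor \<open>mat 1 + s\<close> squares to the identity.\<close>
    have "(mat 1 + s) ** (mat 1 + s) = transpose (F M ** (mat 1 + s)) ** (F M ** (mat 1 + s))"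
    proof -
      have "transpose (F M ** (mat 1 + s)) ** (F M ** (mat 1 + s)) =
          transpose (mat 1 + s) ** (transpose (F M) ** F M) ** (mat 1 + s)"
        by (simp only: matrix_transpose_mul matrix_mul_assoc)
      then show ?thesis
        by (simp add: FM(2) transpose_linear_simps s_def transpose_sym_part)
    qed
    also have "\<dots> = mat 1"
      using Q(1) by (simp only: M(2)[folded s_def] orthogonal_matrix)
    finally have "2 *\<^sub>R s = - (s ** s)"
      by (simp add: matrix_algebra scaleR_2 eq_neg_iff_add_eq_0 add.assoc)
    then have "2 * norm s = norm (s ** s)"
      by (metis norm_minus_cancel norm_scaleR abs_numeral)
    also have "\<dots> \<le> norm s * norm s * C"
      by (rule C(2))
    finally have "norm s * (2 - C * norm s) \<le> 0"
      by (simp add: algebra_simps)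
    moreover have "0 < 2 - C * norm s"
      using M(1) C(1) by (simp add: N'_def s_def field_simps)
    ultimately have "s = 0"
      by (simp add: mult_le_0_iff)
    then show ?thesis
      using M(2) FM(1) by (simp add: s_def)
  qed
  then show ?thesis
    using that e(1) by blast
qed

lemma mat_1_in_restricted_holonomy:
  fixes X :: "real^'d^'n"
  assumes "X \<in> total_space" shows "mat 1 \<in> restricted_holonomy (bundle_proj X) X"
proof (rule restricted_holonomyI)
  show "horizontal_path (linepath X X)"
    using assms by (intro horizontal_path_linepath) (auto simp: matrix_transpose_mul)
  show "homotopic_paths (base_space TYPE('d)) (bundle_proj \<circ> linepath X X) (linepath (bundle_proj X) (bundle_proj X))"
    using assms by (intro homotopic_paths_eq) (auto simp: base_space_def linepath_refl path_image_def path_def comp_def)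
qed (simp_all add: orthogonal_matrix_id)

theorem theorem3:
  fixes p :: "real^'n^'n" and Xp :: "real^'d^'n"
  assumes "2 \<le> CARD('d)" and "CARD('d) \<le> CARD('n)"
    and "p \<in> base_space TYPE('d)"
    and "Xp \<in> total_space" and "bundle_proj Xp = p"
    and "span (transported_curvature_values Xp) = skew_matrices"
  shows "restricted_holonomy p Xp = {Q. rotation_matrix Q}"
proof -
  let ?H = "restricted_holonomy p Xp"
  have rot: "rotation_matrix Q" if "Q \<in> ?H" for Q
    using restricted_holonomy_subset[OF assms(4) that] .
  have curve: "\<exists>\<epsilon> c. 0 < \<epsilon> \<and> continuous_on (ball 0 \<epsilon>) c \<and> c 0 = mat 1 \<and>
      (c has_vector_derivative A) (at 0) \<and> (\<forall>t\<in>ball 0 \<epsilon>. c t \<in> ?H)"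
    if "A \<in> transported_curvature_values Xp" for A
    using curvature_holonomy_curve[OF that] unfolding assms(5) by metis
  have one: "mat 1 \<in> ?H"
    using mat_1_in_restricted_holonomy[OF assms(4)] by (simp only: assms(5))
  obtain e where e: "0 < e" "\<And>Q. orthogonal_matrix Q \<Longrightarrow> dist Q (mat 1) < e \<Longrightarrow> Q \<in> ?H"
    by (rule identity_neighbourhood[OF restricted_holonomy_mult one _ assms(6) curve, rotated 3])
      (use rot in \<open>auto simp: rotation_matrix_def\<close>)
  interpret near_identity_monoid ?H e
    by unfold_locales (use restricted_holonomy_mult e rot in blast)+
  show ?thesis
    using rot rotation_in by blast
qed

end
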